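(* Let $\lambda>0$ and let $L$ be a two-sided real-valued Lévy process with Lévy measure $\nu$ satisfying $\int_{|x|>1}\log|x|\,\nu(dx)<\infty$. Let $$X_t=\int_{-\infty}^\infty e^{-\lambda|t-s|}\,dL_s,\qquad t\ge0 .$$ Then the process $(X_t)_{t\ge0}$ is of finite variation on compacts, and hence it is a semimartingale with respect to any filtration it is adapted to. Furthermore, the process is locally Lipschitz continuous, i.e. almost surely the path $t\mapsto X_t$ is Lipschitz continuous on every compact subinterval of $[0,\infty)$.
   Context: A Lévy process with characteristic triplet $(\gamma,\sigma^2,\nu)$ satisfies $E(e^{iuL_t})=e^{t\psi(u)}$ with $\psi(u)=iu\gamma-\sigma^2\frac{u^2}{2}+\int(e^{iux}-1-iux1_{|x|\le1})\,\nu(dx)$, where $\int(1\wedge x^2)\,\nu(dx)<\infty$. The two-sided version is obtained from two independent copies $L^{(1)},L^{(2)}$ by $L_t=L^{(1)}_t$ for $t\ge0$ and $L_t=-L^{(2)}_{(-t)-}$ for $t<0$. Integrals of deterministic functions over $\mathbb{R}$ with respect to $L$ are meant in the sense of Rajput and Rosinski: with $\Lambda$ the independently scattered random measure on bounded Borel sets associated with $L$ (so $\Lambda((a,b])=L_b-L_a$), a measurable $f$ is integrable if there are step functions $g_n\to f$ Lebesgue-a.e. such that $\lim_n\int_Ag_n\,d\Lambda$ exists in probability for every Borel set $A$, and then $\int_{\mathbb{R}} f\,dL_s=\lim_n\int_{\mathbb{R}} g_n\,d\Lambda$. Under the stated assumptions the integrals defining $X_t$ exist. Since each $X_t$ is a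 priori defined only up to a null set, $X$ is understood as the càdlàg version of the process (which exists and is unique up to indistinguishability), and path properties are understood to hold almost surely, with processes identified up to indistinguishability. *)

theory Defs
  imports "HOL-Probability.Probability"
begin

text \<open>A process indexed by \<open>[0, \<infinity>)\<close> is a function \<open>X :: real \<Rightarrow> 'a \<Rightarrow> real\<close> whose values at negative
  times are ignored. Path properties hold almost surely, so neither the probability space nor the
  filtrations need to be complete.\<close>

section \<open>Levy processes\<close>

definition cadlag :: "(real \<Rightarrow> real) \<Rightarrow> bool" where
  "cadlag f \<longleftrightarrow> (\<forall>t\<ge>0. continuous (at_right t) f) \<and> (\<forall>t>0. \<exists>l. (f \<longlongrightarrow> l) (at_left t))"

text \<open>Repeated values of \<open>t\<close> are allowed, so the increments along an infinite increasing sequence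
  also cover those along finite increasing sequences.\<close>

definition levy_process :: "'a measure \<Rightarrow> (real \<Rightarrow> 'a \<Rightarrow> real) \<Rightarrow> bool" where
  "levy_process M L \<longleftrightarrow>
     prob_space M \<and>
     (\<forall>t\<ge>0. L t \<in> borel_measurable M) \<and>
     (AE \<omega> in M. L 0 \<omega> = 0) \<and>
     (\<forall>t :: nat \<Rightarrow> real. 0 \<le> t 0 \<longrightarrow> incseq t \<longrightarrow>
        prob_space.indep_vars M (\<lambda>_. borel) (\<lambda>i \<omega>. L (t (Suc i)) \<omega> - L (t i) \<omega>) UNIV) \<and>
     (\<forall>s\<ge>0. \<forall>h\<ge>0. distr M borel (\<lambda>\<omega>. L (s + h) \<omega> - L s \<omega>) = distr M borel (L h)) \<and>
     (AE \<omega> in M. cadlag (\<lambda>t. L t \<omega>))"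

definition levy_measure :: "real measure \<Rightarrow> bool" where
  "levy_measure \<nu> \<longleftrightarrow>
     sets \<nu> = sets borel \<and> emeasure \<nu> {0} = 0 \<and> integrable \<nu> (\<lambda>x. min 1 (x\<^sup>2))"

definition levy_exponent :: "real \<Rightarrow> real \<Rightarrow> real measure \<Rightarrow> real \<Rightarrow> complex" where
  "levy_exponent \<gamma> \<sigma> \<nu> u =
     \<i> * u * \<gamma> - \<sigma>\<^sup>2 * u\<^sup>2 / 2 +
     (CLINT x|\<nu>. iexp (u * x) - 1 - \<i> * u * x * of_real (indicator {-1..1} x))"

text \<open>\<open>\<sigma>\<close> stands for the square root of the Gaussian variance: the triplet is \<open>(\<gamma>, \<sigma>\<^sup>2, \<nu>)\<close>.\<close>

definition characteristic_triplet ::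
  "'a measure \<Rightarrow> (real \<Rightarrow> 'a \<Rightarrow> real) \<Rightarrow> real \<Rightarrow> real \<Rightarrow> real measure \<Rightarrow> bool" where
  "characteristic_triplet M L \<gamma> \<sigma> \<nu> \<longleftrightarrow>
     levy_measure \<nu> \<and>
     (\<forall>t\<ge>0. \<forall>u. char (distr M borel (L t)) u = exp (t * levy_exponent \<gamma> \<sigma> \<nu> u))"

abbreviation path_space :: "(real \<Rightarrow> real) measure" where
  "path_space \<equiv> PiM {0..} (\<lambda>_. borel)"

definition path_map :: "(real \<Rightarrow> 'a \<Rightarrow> real) \<Rightarrow> 'a \<Rightarrow> real \<Rightarrow> real" where
  "path_map X \<omega> = (\<lambda>t\<in>{0..}. X t \<omega>)"

definition two_sided_levy_process ::
  "'a measure \<Rightarrow> (real \<Rightarrow> 'a \<Rightarrow> real) \<Rightarrow> real \<Rightarrow> real \<Rightarrow> real measure \<Rightarrow> bool" where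
  "two_sided_levy_process M L \<gamma> \<sigma> \<nu> \<longleftrightarrow>
     (\<forall>t. L t \<in> borel_measurable M) \<and>
     (\<exists>L1 L2.
        levy_process M L1 \<and> characteristic_triplet M L1 \<gamma> \<sigma> \<nu> \<and>
        levy_process M L2 \<and>
        distr M path_space (path_map L1) = distr M path_space (path_map L2) \<and>
        prob_space.indep_var M path_space (path_map L1) path_space (path_map L2) \<and>
        (AE \<omega> in M. (\<forall>t\<ge>0. L t \<omega> = L1 t \<omega>) \<and>
                     (\<forall>t<0. ((\<lambda>s. L2 s \<omega>) \<longlongrightarrow> - L t \<omega>) (at_left (- t)))))"


section \<open>The integral of Rajput and Rosinski\<close>

definition independently_scattered :: "'a measure \<Rightarrow> (real set \<Rightarrow> 'a \<Rightarrow> real) \<Rightarrow> bool" where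
  "independently_scattered M \<Lambda> \<longleftrightarrow>
     (\<forall>A\<in>sets borel. bounded A \<longrightarrow> \<Lambda> A \<in> borel_measurable M) \<and>
     (\<forall>A :: nat \<Rightarrow> real set.
        (\<forall>i. A i \<in> sets borel \<and> bounded (A i)) \<longrightarrow> disjoint_family A \<longrightarrow>
        prob_space.indep_vars M (\<lambda>_. borel) (\<lambda>i. \<Lambda> (A i)) UNIV \<and>
        (bounded (\<Union>i. A i) \<longrightarrow> (AE \<omega> in M. (\<lambda>i. \<Lambda> (A i) \<omega>) sums \<Lambda> (\<Union>i. A i) \<omega>)))"

definition levy_random_measure ::
  "'a measure \<Rightarrow> (real \<Rightarrow> 'a \<Rightarrow> real) \<Rightarrow> (real set \<Rightarrow> 'a \<Rightarrow> real) \<Rightarrow> bool" where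
  "levy_random_measure M L \<Lambda> \<longleftrightarrow>
     independently_scattered M \<Lambda> \<and>
     (\<forall>a b. a \<le> b \<longrightarrow> (AE \<omega> in M. \<Lambda> {a<..b} \<omega> = L b \<omega> - L a \<omega>))"

text \<open>As in Rajput and Rosinski, the steps of a step function are bounded Borel sets, not
  necessarily intervals.\<close>

definition step_function :: "(real \<Rightarrow> real) \<Rightarrow> bool" where
  "step_function g \<longleftrightarrow> simple_function borel g \<and> bounded {s. g s \<noteq> 0}"

definition step_integral ::
  "(real set \<Rightarrow> 'a \<Rightarrow> real) \<Rightarrow> real set \<Rightarrow> (real \<Rightarrow> real) \<Rightarrow> 'a \<Rightarrow> real" where
  "step_integral \<Lambda> A g \<omega> = (\<Sum>c\<in>range g - {0}. c * \<Lambda> (A \<inter> g -` {c}) \<omega>)"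

definition tendsto_in_prob ::
  "'a measure \<Rightarrow> (nat \<Rightarrow> 'a \<Rightarrow> real) \<Rightarrow> ('a \<Rightarrow> real) \<Rightarrow> bool" where
  "tendsto_in_prob M Z Y \<longleftrightarrow>
     (\<forall>\<epsilon>>0. (\<lambda>n. measure M {\<omega> \<in> space M. \<bar>Z n \<omega> - Y \<omega>\<bar> > \<epsilon>}) \<longlonglongrightarrow> 0)"

definition has_levy_integral ::
  "'a measure \<Rightarrow> (real set \<Rightarrow> 'a \<Rightarrow> real) \<Rightarrow> (real \<Rightarrow> real) \<Rightarrow> ('a \<Rightarrow> real) \<Rightarrow> bool" where
  "has_levy_integral M \<Lambda> f Y \<longleftrightarrow>
     f \<in> borel_measurable borel \<and> Y \<in> borel_measurable M \<and>
     (\<exists>g. (\<forall>n. step_function (g n)) \<and>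
          (AE s in lborel. (\<lambda>n. g n s) \<longlonglongrightarrow> f s) \<and>
          (\<forall>A\<in>sets borel. \<exists>Z\<in>borel_measurable M.
             tendsto_in_prob M (\<lambda>n. step_integral \<Lambda> A (g n)) Z) \<and>
          tendsto_in_prob M (\<lambda>n. step_integral \<Lambda> UNIV (g n)) Y)"


section \<open>Finite variation processes and semimartingales\<close>

definition finite_variation_on :: "real set \<Rightarrow> (real \<Rightarrow> real) \<Rightarrow> bool" where
  "finite_variation_on S f \<longleftrightarrow>
     (\<exists>B. \<forall>n. \<forall>p :: nat \<Rightarrow> real. incseq p \<longrightarrow> range p \<subseteq> S \<longrightarrow>
        (\<Sum>i<n. \<bar>f (p (Suc i)) - f (p i)\<bar>) \<le> B)"

definition finite_variation_paths :: "'a measure \<Rightarrow> (real \<Rightarrow> 'a \<Rightarrow> real) \<Rightarrow> bool" where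
  "finite_variation_paths M X \<longleftrightarrow>
     (AE \<omega> in M. \<forall>a b. 0 \<le> a \<longrightarrow> finite_variation_on {a..b} (\<lambda>t. X t \<omega>))"

text \<open>The locale \<^locale>\<open>filtration\<close> and \<^const>\<open>stopping_time\<close> are indexed by all values of a
  type; here filtrations are indexed by \<open>[0, \<infinity>)\<close> and stopping times may take the value \<open>\<infinity>\<close>.\<close>

definition filtration_nonneg :: "'a measure \<Rightarrow> (real \<Rightarrow> 'a measure) \<Rightarrow> bool" where
  "filtration_nonneg M F \<longleftrightarrow>
     (\<forall>t\<ge>0. subalgebra M (F t)) \<and> (\<forall>s t. 0 \<le> s \<longrightarrow> s \<le> t \<longrightarrow> subalgebra (F t) (F s))"

definition adapted :: "(real \<Rightarrow> 'a measure) \<Rightarrow> (real \<Rightarrow> 'a \<Rightarrow> real) \<Rightarrow> bool" where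
  "adapted F X \<longleftrightarrow> (\<forall>t\<ge>0. X t \<in> borel_measurable (F t))"

definition martingale ::
  "'a measure \<Rightarrow> (real \<Rightarrow> 'a measure) \<Rightarrow> (real \<Rightarrow> 'a \<Rightarrow> real) \<Rightarrow> bool" where
  "martingale M F X \<longleftrightarrow>
     adapted F X \<and> (\<forall>t\<ge>0. integrable M (X t)) \<and>
     (\<forall>s t. 0 \<le> s \<longrightarrow> s \<le> t \<longrightarrow> (AE \<omega> in M. real_cond_exp M (F s) (X t) \<omega> = X s \<omega>))"

definition extended_stopping_time ::
  "'a measure \<Rightarrow> (real \<Rightarrow> 'a measure) \<Rightarrow> ('a \<Rightarrow> ennreal) \<Rightarrow> bool" where
  "extended_stopping_time M F T \<longleftrightarrow>
     (\<forall>t\<ge>0. {\<omega> \<in> space M. T \<omega> \<le> ennreal t} \<in> sets (F t))"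

definition stopped :: "(real \<Rightarrow> 'a \<Rightarrow> real) \<Rightarrow> ('a \<Rightarrow> ennreal) \<Rightarrow> real \<Rightarrow> 'a \<Rightarrow> real" where
  "stopped X T t \<omega> = X (enn2real (min (ennreal t) (T \<omega>))) \<omega>"

definition local_martingale ::
  "'a measure \<Rightarrow> (real \<Rightarrow> 'a measure) \<Rightarrow> (real \<Rightarrow> 'a \<Rightarrow> real) \<Rightarrow> bool" where
  "local_martingale M F X \<longleftrightarrow>
     adapted F X \<and> (AE \<omega> in M. cadlag (\<lambda>t. X t \<omega>)) \<and>
     (\<exists>T :: nat \<Rightarrow> 'a \<Rightarrow> ennreal.
        (\<forall>n. extended_stopping_time M F (T n)) \<and>
        (AE \<omega> in M. incseq (\<lambda>n. T n \<omega>) \<and> (SUP n. T n \<omega>) = \<infinity>) \<and>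
        (\<forall>n. martingale M F (\<lambda>t \<omega>. stopped X (T n) t \<omega> - X 0 \<omega>)))"

definition semimartingale ::
  "'a measure \<Rightarrow> (real \<Rightarrow> 'a measure) \<Rightarrow> (real \<Rightarrow> 'a \<Rightarrow> real) \<Rightarrow> bool" where
  "semimartingale M F X \<longleftrightarrow>
     adapted F X \<and>
     (\<exists>N V.
        local_martingale M F N \<and> (AE \<omega> in M. N 0 \<omega> = 0) \<and>
        adapted F V \<and> (AE \<omega> in M. cadlag (\<lambda>t. V t \<omega>)) \<and>
        finite_variation_paths M V \<and> (AE \<omega> in M. V 0 \<omega> = 0) \<and>
        (AE \<omega> in M. \<forall>t\<ge>0. X t \<omega> = X 0 \<omega> + N t \<omega> + V t \<omega>))"

end

theory Submission
  imports Defs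
begin

text \<open>For \<open>t\<close> in \<open>[0, T]\<close> the kernel \<open>f t s = exp (- l * \<bar>t - s\<bar>)\<close> agrees off \<open>[0, T]\<close> with a linear combination
  of \<open>f 0\<close> and \<open>f T\<close> whose coefficients are smooth in \<open>t\<close>. Hence \<open>X t - X r\<close> is, up to Lipschitz multiples of
  \<open>X 0\<close> and \<open>X T\<close>, the integral of a Lipschitz function \<open>h\<close> supported in \<open>[0, T]\<close>. Summation by parts
  bounds its Riemann sums by \<open>sup \<bar>L\<bar>\<close> on \<open>[0, T]\<close> times the total variation of \<open>h\<close>, which is of order
  \<open>t - r\<close>. This gives the Lipschitz bound at rational times, and right continuity extends it to all times.

  The integral is only given as a limit along some unknown step functions, so one has to know that
  the Riemann sums have the same limit. If step functions \<open>g n\<close> tend to \<open>0\<close> almost everywhere and their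
  integrals over every Borel set are Cauchy in probability, a gliding hump argument
  shows that the limits vanish; smallness of integrals is read off from the characteristic function
  \<open>exp (\<integral> \<psi> (u * g s) ds)\<close>.\<close>

section \<open>Convergence in probability\<close>

text \<open>The definition of the integral grants only that, for each Borel set separately, the
  integrals of the approximating step functions converge in probability. Almost everywhere
  convergence of the integrands alone controls nothing: they may be huge on small sets or far out. A
  spurious limit is excluded by choosing the Borel set after the sequence, hence the gliding hump.
  One null subsequence is enough, because the whole sequence already has a limit. The linear
  combination exists because, for \<open>t\<close> in \<open>[0, T]\<close>, the kernel factors as
  \<open>exp (- l * t) * exp (l * s)\<close> for \<open>s \<le> 0\<close> and as
  \<open>exp (l * t) * exp (- l * s)\<close> for \<open>s \<ge> T\<close>. Since \<open>h\<close>
  vanishes at 0 and \<open>T\<close>, summation by parts leaves no boundary terms, and only values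
  of \<open>L\<close> on \<open>[0, T]\<close> enter, where its paths are bounded. Each statement
  about an integral holds off a null set depending on the times involved, hence the detour through
  rational times. The bound \<open>C\<close> on the path of \<open>L\<close> is random and therefore
  quantified inside the almost sure statements.\<close>

lemma tendsto_in_prob_subseq:
  assumes "tendsto_in_prob M Z Y" "strict_mono r"
  shows "tendsto_in_prob M (\<lambda>n. Z (r n)) Y"
  using assms LIMSEQ_subseq_LIMSEQ[OF _ assms(2)]
  unfolding tendsto_in_prob_def comp_def by blast

context prob_space
begin

text \<open>The bounded distance turns convergence in probability into convergence in L1, so that
  almost surely convergent subsequences and tests against a bounded continuous function become
  available.\<close>

lemma tendsto_in_prob_iff_L1:
  assumes [measurable]: "\<And>n. Z n \<in> borel_measurable M" "Y \<in> borel_measurable M"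
  shows "tendsto_in_prob M Z Y \<longleftrightarrow>
    (\<lambda>n. expectation (\<lambda>\<omega>. min 1 \<bar>Z n \<omega> - Y \<omega>\<bar>)) \<longlonglongrightarrow> 0"
proof
  have int: "integrable M (\<lambda>\<omega>. min 1 \<bar>Z n \<omega> - Y \<omega>\<bar>)" for n
    by (rule integrable_const_bound[where B=1]) auto
  show "(\<lambda>n. expectation (\<lambda>\<omega>. min 1 \<bar>Z n \<omega> - Y \<omega>\<bar>)) \<longlonglongrightarrow> 0" if "tendsto_in_prob M Z Y"
  proof (rule LIMSEQ_I)
    fix e :: real assume e: "e > 0"
    define A where "A n = {\<omega> \<in> space M. \<bar>Z n \<omega> - Y \<omega>\<bar> > e / 2}" for n
    have [measurable]: "A n \<in> sets M" for n unfolding A_def by measurable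
    have bnd: "expectation (\<lambda>\<omega>. min 1 \<bar>Z n \<omega> - Y \<omega>\<bar>) \<le> e / 2 + prob (A n)" for n
    proof -
      have "expectation (\<lambda>\<omega>. min 1 \<bar>Z n \<omega> - Y \<omega>\<bar>)
          \<le> expectation (\<lambda>\<omega>. e / 2 + indicator (A n) \<omega>)"
        proof (rule integral_mono[OF int])
          show "integrable M (\<lambda>\<omega>. e / 2 + indicator (A n) \<omega>)"
            by (intro Bochner_Integration.integrable_add) (auto simp: emeasure_eq_measure)
          show "min 1 \<bar>Z n \<omega> - Y \<omega>\<bar> \<le> e / 2 + indicator (A n) \<omega>" if "\<omega> \<in> space M" for \<omega>
            using that e by (cases "\<omega> \<in> A n") (auto simp: A_def min_def)
        qed
      also have "\<dots> = e / 2 + prob (A n)"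
        by (subst Bochner_Integration.integral_add) (auto simp: emeasure_eq_measure prob_space)
      finally show ?thesis .
    qed
    have "(\<lambda>n. prob (A n)) \<longlonglongrightarrow> 0"
      using that e unfolding tendsto_in_prob_def A_def by (auto dest: spec[of _ "e/2"])
    then obtain N where N: "\<And>n. n \<ge> N \<Longrightarrow> prob (A n) < e / 2"
      using order_tendstoD(2)[of _ 0 sequentially "e/2"] e
      by (auto simp: eventually_sequentially)
    have "norm (expectation (\<lambda>\<omega>. min 1 \<bar>Z n \<omega> - Y \<omega>\<bar>) - 0) < e" if "n \<ge> N" for n
      using bnd[of n] N[OF that] by (simp add: integral_nonneg_AE)
    then show "\<exists>N. \<forall>n\<ge>N. norm (expectation (\<lambda>\<omega>. min 1 \<bar>Z n \<omega> - Y \<omega>\<bar>) - 0) < e"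
      by blast
  qed
  show "tendsto_in_prob M Z Y"
    if *: "(\<lambda>n. expectation (\<lambda>\<omega>. min 1 \<bar>Z n \<omega> - Y \<omega>\<bar>)) \<longlonglongrightarrow> 0"
    unfolding tendsto_in_prob_def
  proof safe
    fix e :: real assume e: "e > 0"
    \<comment> \<open>The distance is truncated at 1, so for \<open>e > 1\<close> Markov's
      inequality has to be applied at level 1.\<close>
    define d where "d = min 1 e"
    have d: "d > 0" using e by (auto simp: d_def)
    have bnd: "prob {\<omega> \<in> space M. e < \<bar>Z n \<omega> - Y \<omega>\<bar>} \<le>
        expectation (\<lambda>\<omega>. min 1 \<bar>Z n \<omega> - Y \<omega>\<bar>) / d" for n
    proof -
      have "prob {\<omega> \<in> space M. e < \<bar>Z n \<omega> - Y \<omega>\<bar>}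
          \<le> prob {\<omega> \<in> space M. min 1 \<bar>Z n \<omega> - Y \<omega>\<bar> \<ge> d}"
        by (rule finite_measure_mono) (auto simp: d_def)
      also have "\<dots> \<le> expectation (\<lambda>\<omega>. min 1 \<bar>Z n \<omega> - Y \<omega>\<bar>) / d"
        by (rule integral_Markov_inequality_measure[where A="{}"]) (use int d in auto)
      finally show ?thesis .
    qed
    show "(\<lambda>n. prob {\<omega> \<in> space M. e < \<bar>Z n \<omega> - Y \<omega>\<bar>}) \<longlonglongrightarrow> 0"
      by (rule Lim_null_comparison[OF always_eventually tendsto_divide_zero[OF *, of d]])
        (use bnd in simp)
  qed
qed

lemma tendsto_in_prob_AE_subseq:
  assumes [measurable]: "\<And>n. Z n \<in> borel_measurable M" "Y \<in> borel_measurable M"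
    and "tendsto_in_prob M Z Y"
  obtains r where "strict_mono r" "AE \<omega> in M. (\<lambda>n. Z (r n) \<omega>) \<longlonglongrightarrow> Y \<omega>"
proof -
  have int: "integrable M (\<lambda>\<omega>. min 1 \<bar>Z n \<omega> - Y \<omega>\<bar>)" for n
    by (rule integrable_const_bound[where B=1]) auto
  have eq: "norm (min 1 \<bar>x\<bar>) = min 1 \<bar>x\<bar>" for x :: real by auto
  have "(\<lambda>n. expectation (\<lambda>\<omega>. norm (min 1 \<bar>Z n \<omega> - Y \<omega>\<bar>))) \<longlonglongrightarrow> 0"
    using assms(3) unfolding eq by (subst (asm) tendsto_in_prob_iff_L1) auto
  from tendsto_L1_AE_subseq[OF int this] obtain r where
    r: "strict_mono r" "AE \<omega> in M. (\<lambda>n. min 1 \<bar>Z (r n) \<omega> - Y \<omega>\<bar>) \<longlonglongrightarrow> 0" by blast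
  have *: "f \<longlonglongrightarrow> y" if "(\<lambda>n. min 1 \<bar>f n - y\<bar>) \<longlonglongrightarrow> 0" for f :: "nat \<Rightarrow> real" and y
  proof -
    have ev: "eventually (\<lambda>n. min 1 \<bar>f n - y\<bar> < 1) sequentially"
      using order_tendstoD(2)[OF that, of 1] by simp
    then have "eventually (\<lambda>n. min 1 \<bar>f n - y\<bar> = \<bar>f n - y\<bar>) sequentially"
      by eventually_elim (simp add: min_def split: if_splits)
    with that have "(\<lambda>n. \<bar>f n - y\<bar>) \<longlonglongrightarrow> 0"
      by (rule Lim_transform_eventually)
    then show ?thesis
      by (rule LIM_zero_cancel[OF tendsto_rabs_zero_cancel])
  qed
  have "AE \<omega> in M. (\<lambda>n. Z (r n) \<omega>) \<longlonglongrightarrow> Y \<omega>"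
    using r(2) by eventually_elim (rule *)
  with r(1) show ?thesis by (rule that)
qed

lemma tendsto_in_prob_cong_AE:
  assumes [measurable]: "\<And>n. Z n \<in> borel_measurable M" "\<And>n. Z' n \<in> borel_measurable M"
    "Y \<in> borel_measurable M"
    and "\<And>n. AE \<omega> in M. Z n \<omega> = Z' n \<omega>"
    and "tendsto_in_prob M Z Y"
  shows "tendsto_in_prob M Z' Y"
proof -
  have "prob {\<omega> \<in> space M. \<bar>Z n \<omega> - Y \<omega>\<bar> > e} = prob {\<omega> \<in> space M. \<bar>Z' n \<omega> - Y \<omega>\<bar> > e}" for n e
    by (rule measure_eq_AE) (use assms(4)[of n] in auto)
  with assms(5) show ?thesis by (simp add: tendsto_in_prob_def)
qed

lemma tendsto_in_prob_add:
  assumes [measurable]: "\<And>n. Z n \<in> borel_measurable M" "\<And>n. Z' n \<in> borel_measurable M"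
    "Y \<in> borel_measurable M" "Y' \<in> borel_measurable M"
    and Y: "tendsto_in_prob M Z Y" and Y': "tendsto_in_prob M Z' Y'"
  shows "tendsto_in_prob M (\<lambda>n \<omega>. Z n \<omega> + Z' n \<omega>) (\<lambda>\<omega>. Y \<omega> + Y' \<omega>)"
  unfolding tendsto_in_prob_def
proof safe
  fix e :: real assume e: "e > 0"
  have "prob {\<omega> \<in> space M. e < \<bar>Z n \<omega> + Z' n \<omega> - (Y \<omega> + Y' \<omega>)\<bar>}
      \<le> prob {\<omega> \<in> space M. e / 2 < \<bar>Z n \<omega> - Y \<omega>\<bar>} + prob {\<omega> \<in> space M. e / 2 < \<bar>Z' n \<omega> - Y' \<omega>\<bar>}"
    (is "?l n \<le> ?a n + ?b n") for n
  proof -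
    have "?l n \<le> prob ({\<omega> \<in> space M. e / 2 < \<bar>Z n \<omega> - Y \<omega>\<bar>} \<union> {\<omega> \<in> space M. e / 2 < \<bar>Z' n \<omega> - Y' \<omega>\<bar>})"
    proof (rule finite_measure_mono)
      show "{\<omega> \<in> space M. e < \<bar>Z n \<omega> + Z' n \<omega> - (Y \<omega> + Y' \<omega>)\<bar>} \<subseteq>
        {\<omega> \<in> space M. e / 2 < \<bar>Z n \<omega> - Y \<omega>\<bar>} \<union> {\<omega> \<in> space M. e / 2 < \<bar>Z' n \<omega> - Y' \<omega>\<bar>}"
      proof
        fix \<omega> assume *: "\<omega> \<in> {\<omega> \<in> space M. e < \<bar>Z n \<omega> + Z' n \<omega> - (Y \<omega> + Y' \<omega>)\<bar>}"
        then have "e / 2 < \<bar>Z n \<omega> - Y \<omega>\<bar> \<or> e / 2 < \<bar>Z' n \<omega> - Y' \<omega>\<bar>"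
          by (simp only: mem_Collect_eq) argo
        with * show "\<omega> \<in> {\<omega> \<in> space M. e / 2 < \<bar>Z n \<omega> - Y \<omega>\<bar>} \<union>
            {\<omega> \<in> space M. e / 2 < \<bar>Z' n \<omega> - Y' \<omega>\<bar>}" by blast
      qed
    qed measurable
    also have "\<dots> \<le> ?a n + ?b n"
      by (rule measure_Un_le) auto
    finally show ?thesis .
  qed
  moreover have "(\<lambda>n. ?a n + ?b n) \<longlonglongrightarrow> 0"
    using Y[unfolded tendsto_in_prob_def, rule_format, OF half_gt_zero[OF e]]
      Y'[unfolded tendsto_in_prob_def, rule_format, OF half_gt_zero[OF e]]
    by (rule tendsto_add_zero)
  ultimately show "?l \<longlonglongrightarrow> 0"
    by (intro Lim_null_comparison[of ?l "\<lambda>n. ?a n + ?b n"] always_eventually)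
      (simp_all add: measure_nonneg)
qed

lemma tendsto_in_prob_cmult:
  assumes "tendsto_in_prob M Z Y"
  shows "tendsto_in_prob M (\<lambda>n \<omega>. c * Z n \<omega>) (\<lambda>\<omega>. c * Y \<omega>)"
proof (cases "c = 0")
  case True
  then show ?thesis by (simp add: tendsto_in_prob_def)
next
  case False
  have eq: "e < \<bar>c * x - c * y\<bar> \<longleftrightarrow> e / \<bar>c\<bar> < \<bar>x - y\<bar>" for e x y :: real
    using False by (simp add: abs_mult pos_divide_less_eq mult.commute flip: right_diff_distrib)
  show ?thesis using assms False unfolding tendsto_in_prob_def eq by simp
qed

lemma tendsto_in_prob_add_cmult:
  assumes [measurable]: "\<And>n. Z n \<in> borel_measurable M" "\<And>n. Z' n \<in> borel_measurable M"
    "Y \<in> borel_measurable M" "Y' \<in> borel_measurable M"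
    and "tendsto_in_prob M Z Y" and "tendsto_in_prob M Z' Y'"
  shows "tendsto_in_prob M (\<lambda>n \<omega>. Z n \<omega> + c * Z' n \<omega>) (\<lambda>\<omega>. Y \<omega> + c * Y' \<omega>)"
  by (rule tendsto_in_prob_add) (use assms tendsto_in_prob_cmult in auto)

text \<open>Levy's continuity theorem gives weak convergence to the point mass at 0. As the limit is
  constant, testing against \<open>min 1 \<bar>x\<bar>\<close> upgrades this to convergence in
  probability.\<close>

lemma tendsto_in_prob_zero_if_char:
  assumes [measurable]: "\<And>n. Z n \<in> borel_measurable M"
    and "\<And>u. (\<lambda>n. char (distr M borel (Z n)) u) \<longlonglongrightarrow> 1"
  shows "tendsto_in_prob M Z (\<lambda>_. 0)"
proof -
  let ?\<delta> = "distr M borel (\<lambda>_. 0 :: real)"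
  have char0: "char ?\<delta> u = 1" for u
    unfolding char_def by (subst integral_distr) (auto simp: prob_space)
  have "weak_conv_m (\<lambda>n. distr M borel (Z n)) ?\<delta>"
    by (rule levy_continuity) (use assms(2) in \<open>auto simp: char0 simp del: distr_const\<close>)
  then have "(\<lambda>n. integral\<^sup>L (distr M borel (Z n)) (\<lambda>x. min 1 \<bar>x\<bar>)) \<longlonglongrightarrow> integral\<^sup>L ?\<delta> (\<lambda>x. min 1 \<bar>x\<bar>)"
    by (intro weak_conv_imp_integral_bdd_continuous_conv[where B=1])
      (auto simp del: distr_const intro!: continuous_intros)
  also have "integral\<^sup>L ?\<delta> (\<lambda>x. min 1 \<bar>x\<bar>) = 0"
    by (subst integral_distr) auto
  also have "(\<lambda>n. integral\<^sup>L (distr M borel (Z n)) (\<lambda>x. min 1 \<bar>x\<bar>)) =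
      (\<lambda>n. expectation (\<lambda>\<omega>. min 1 \<bar>Z n \<omega> - 0\<bar>))"
    by (subst integral_distr) auto
  finally show ?thesis
    by (subst tendsto_in_prob_iff_L1) auto
qed

end

section \<open>Step integrals\<close>

lemma step_functionD:
  assumes "step_function g"
  shows "finite (range g)" "g \<in> borel_measurable borel" "g -` {c} \<in> sets borel"
    "bounded {s. g s \<noteq> 0}" "c \<noteq> 0 \<Longrightarrow> bounded (A \<inter> g -` {c})"
proof -
  show fin: "finite (range g)" and bdd: "bounded {s. g s \<noteq> 0}"
    using assms by (auto simp: step_function_def simple_function_def)
  show *: "g \<in> borel_measurable borel"
    using assms by (auto simp: step_function_def intro: borel_measurable_simple_function)
  show "g -` {c} \<in> sets borel"
    using measurable_sets[OF *, of "{c}"] by simp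
  show "bounded (A \<inter> g -` {c})" if "c \<noteq> 0"
    by (rule bounded_subset[OF bdd]) (use that in auto)
qed

lemma step_functionI:
  assumes "finite (range g)" "g \<in> borel_measurable borel" "bounded {s. g s \<noteq> 0}"
  shows "step_function g"
  using assms simple_function_borel_measurable[of g borel] by (auto simp: step_function_def)

lemma step_function_add_cmult:
  assumes f: "step_function f" and g: "step_function g"
  shows "step_function (\<lambda>s. f s + c * g s)"
proof (rule step_functionI)
  note [measurable] = step_functionD(2)[OF f] step_functionD(2)[OF g]
  have "range (\<lambda>s. f s + c * g s) \<subseteq> (\<lambda>(x, y). x + c * y) ` (range f \<times> range g)" by auto
  then show "finite (range (\<lambda>s. f s + c * g s))"
    by (rule finite_subset) (use step_functionD(1) f g in blast)
  show "(\<lambda>s. f s + c * g s) \<in> borel_measurable borel" by measurable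
  have "{s. f s + c * g s \<noteq> 0} \<subseteq> {s. f s \<noteq> 0} \<union> {s. g s \<noteq> 0}" by auto
  then show "bounded {s. f s + c * g s \<noteq> 0}"
    by (rule bounded_subset[rotated]) (use step_functionD(4) f g in auto)
qed

text \<open>Valid for every \<open>\<omega>\<close>: level sets of nonzero values lie in the
  support, so both sides evaluate \<open>\<Lambda>\<close> on the same sets.\<close>

lemma step_integral_support:
  "step_integral \<Lambda> A g \<omega> = step_integral \<Lambda> (A \<inter> {s. g s \<noteq> 0}) g \<omega>"
  unfolding step_integral_def
  by (intro sum.cong refl arg_cong2[where f="(*)"] arg_cong[where f="\<lambda>B. \<Lambda> B \<omega>"]) auto

lemma char_cmult:
  assumes [measurable]: "Y \<in> borel_measurable M"
  shows "char (distr M borel (\<lambda>\<omega>. c * Y \<omega>)) u = char (distr M borel Y) (u * c)"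
  unfolding char_def by (simp add: integral_distr mult.assoc)

locale scattered_measure = prob_space M for M :: "'a measure" +
  fixes \<Lambda> :: "real set \<Rightarrow> 'a \<Rightarrow> real"
  assumes scattered: "independently_scattered M \<Lambda>"
begin

lemma measurable_scattered: "B \<in> sets borel \<Longrightarrow> bounded B \<Longrightarrow> \<Lambda> B \<in> borel_measurable M"
  using scattered by (auto simp: independently_scattered_def)

lemma sums_scattered:
  fixes A :: "nat \<Rightarrow> real set"
  assumes "\<And>i. A i \<in> sets borel" "disjoint_family A" "bounded (\<Union>i. A i)"
  shows "AE \<omega> in M. (\<lambda>i. \<Lambda> (A i) \<omega>) sums \<Lambda> (\<Union>i. A i) \<omega>"
proof -
  have "bounded (A i)" for i using assms(3) by (rule bounded_subset) auto
  with assms scattered show ?thesis by (auto simp: independently_scattered_def)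
qed

text \<open>Countable additivity for the constant empty family gives a convergent series of equal
  terms, which must be 0.\<close>

lemma scattered_empty: "AE \<omega> in M. \<Lambda> {} \<omega> = 0"
proof -
  have "AE \<omega> in M. (\<lambda>i::nat. \<Lambda> {} \<omega>) sums \<Lambda> {} \<omega>"
    using sums_scattered[of "\<lambda>_. {}"] by (simp add: disjoint_family_on_def)
  then show ?thesis
  proof eventually_elim
    case (elim \<omega>)
    then have "(\<lambda>i::nat. \<Lambda> {} \<omega>) \<longlonglongrightarrow> 0" by (intro summable_LIMSEQ_zero) (auto simp: sums_iff)
    then show ?case by (simp add: LIMSEQ_const_iff)
  qed
qed

text \<open>\<open>independently_scattered\<close> speaks of sequences. A finite family is
  enumerated and continued by empty sets, whose measure is almost surely 0.\<close>

lemma scattered_UN: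
  assumes I: "finite I" and B: "\<And>i. i \<in> I \<Longrightarrow> B i \<in> sets borel" "\<And>i. i \<in> I \<Longrightarrow> bounded (B i)"
    and disj: "disjoint_family_on B I"
  shows "AE \<omega> in M. \<Lambda> (\<Union>i\<in>I. B i) \<omega> = (\<Sum>i\<in>I. \<Lambda> (B i) \<omega>)"
    and "char (distr M borel (\<lambda>\<omega>. \<Sum>i\<in>I. c i * \<Lambda> (B i) \<omega>)) u =
      (\<Prod>i\<in>I. char (distr M borel (\<Lambda> (B i))) (u * c i))"
proof -
  obtain h where h: "bij_betw h I {0..<card I}"
    using ex_bij_betw_finite_nat[OF I] by blast
  define f where "f = inv_into I h"
  have f: "f (h i) = i" if "i \<in> I" for i
    using that h by (auto simp: f_def bij_betw_def)
  have f': "f n \<in> I" "h (f n) = n" if "n < card I" for n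
    using that h by (auto simp: f_def bij_betw_def inv_into_into f_inv_into_f)
  have hlt: "h i < card I" if "i \<in> I" for i
    using that h by (auto simp: bij_betw_def)
  define A where "A n = (if n < card I then B (f n) else {})" for n
  have A: "A i \<in> sets borel" "bounded (A i)" for i
    using B f' by (auto simp: A_def)
  have dA: "disjoint_family A"
    unfolding disjoint_family_on_def
  proof safe
    fix m n x assume *: "m \<noteq> n" "x \<in> A m" "x \<in> A n"
    then have "m < card I" "n < card I" by (auto simp: A_def split: if_splits)
    moreover from this * have "f m \<noteq> f n" using f' by metis
    ultimately show "x \<in> {}"
      using disj * f' by (auto simp: A_def disjoint_family_on_def)
  qed
  have UA: "(\<Union>n. A n) = (\<Union>i\<in>I. B i)"
  proof safe
    show "x \<in> (\<Union>n. A n)" if "x \<in> B i" "i \<in> I" for x i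
      using that f[of i] hlt[of i] by (intro UN_I[of "h i"]) (auto simp: A_def)
  qed (auto simp: A_def f' split: if_splits)
  have bU: "bounded (\<Union>n. A n)" unfolding UA using I B by (auto intro: bounded_UN)
  show "AE \<omega> in M. \<Lambda> (\<Union>i\<in>I. B i) \<omega> = (\<Sum>i\<in>I. \<Lambda> (B i) \<omega>)"
    using sums_scattered[OF A(1) dA bU] scattered_empty
  proof eventually_elim
    case (elim \<omega>)
    have "(\<lambda>i. \<Lambda> (A i) \<omega>) sums (\<Sum>i\<in>{0..<card I}. \<Lambda> (A i) \<omega>)"
      by (rule sums_finite) (auto simp: A_def elim(2))
    also have "(\<Sum>i\<in>{0..<card I}. \<Lambda> (A i) \<omega>) = (\<Sum>i\<in>I. \<Lambda> (A (h i)) \<omega>)"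
      by (rule sum.reindex_bij_betw[OF h, symmetric])
    also have "\<dots> = (\<Sum>i\<in>I. \<Lambda> (B i) \<omega>)"
      by (rule sum.cong) (auto simp: A_def f hlt)
    finally show ?case using elim(1) by (simp add: UA sums_iff)
  qed
  have "indep_vars (\<lambda>_. borel) (\<lambda>i. \<Lambda> (A i)) UNIV"
    using scattered A dA by (auto simp: independently_scattered_def)
  then have "indep_vars (\<lambda>_. borel) (\<lambda>i. \<Lambda> (A i)) {0..<card I}"
    by (rule indep_vars_subset) auto
  then have "indep_vars (\<lambda>_. borel) (\<lambda>i \<omega>. c (f i) * \<Lambda> (A i) \<omega>) {0..<card I}"
    by (rule indep_vars_compose2) auto
  then have "char (distr M borel (\<lambda>\<omega>. \<Sum>n\<in>{0..<card I}. c (f n) * \<Lambda> (A n) \<omega>)) u =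
      (\<Prod>n\<in>{0..<card I}. char (distr M borel (\<lambda>\<omega>. c (f n) * \<Lambda> (A n) \<omega>)) u)"
    by (rule char_distr_sum)
  also have "\<dots> = (\<Prod>i\<in>I. char (distr M borel (\<lambda>\<omega>. c (f (h i)) * \<Lambda> (A (h i)) \<omega>)) u)"
    by (rule prod.reindex_bij_betw[OF h, symmetric])
  also have "\<dots> = (\<Prod>i\<in>I. char (distr M borel (\<Lambda> (B i))) (u * c i))"
    using B by (intro prod.cong) (auto simp: A_def f hlt char_cmult measurable_scattered)
  also have "(\<lambda>\<omega>. \<Sum>n\<in>{0..<card I}. c (f n) * \<Lambda> (A n) \<omega>) =
      (\<lambda>\<omega>. \<Sum>i\<in>I. c (f (h i)) * \<Lambda> (A (h i)) \<omega>)"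
    by (intro ext sum.reindex_bij_betw[OF h, symmetric])
  also have "\<dots> = (\<lambda>\<omega>. \<Sum>i\<in>I. c i * \<Lambda> (B i) \<omega>)"
    by (intro ext sum.cong) (auto simp: A_def f hlt)
  finally show "char (distr M borel (\<lambda>\<omega>. \<Sum>i\<in>I. c i * \<Lambda> (B i) \<omega>)) u =
      (\<Prod>i\<in>I. char (distr M borel (\<Lambda> (B i))) (u * c i))" .
qed

lemma scattered_Un:
  assumes "A \<in> sets borel" "bounded A" "B \<in> sets borel" "bounded B" "A \<inter> B = {}"
  shows "AE \<omega> in M. \<Lambda> (A \<union> B) \<omega> = \<Lambda> A \<omega> + \<Lambda> B \<omega>"
    and "char (distr M borel (\<Lambda> (A \<union> B))) u =
      char (distr M borel (\<Lambda> A)) u * char (distr M borel (\<Lambda> B)) u"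
proof -
  let ?B = "\<lambda>i::bool. if i then A else B"
  have B: "?B i \<in> sets borel" "bounded (?B i)" for i using assms by auto
  have disj: "disjoint_family_on ?B UNIV"
    using assms by (auto simp: disjoint_family_on_def)
  from scattered_UN[OF finite B disj]
  show AE: "AE \<omega> in M. \<Lambda> (A \<union> B) \<omega> = \<Lambda> A \<omega> + \<Lambda> B \<omega>"
    by (simp add: UNIV_bool Un_commute add.commute)
  note [measurable] = measurable_scattered[OF assms(1,2)] measurable_scattered[OF assms(3,4)]
    measurable_scattered[of "A \<union> B"]
  have "distr M borel (\<Lambda> (A \<union> B)) = distr M borel (\<lambda>\<omega>. \<Sum>i\<in>UNIV. \<Lambda> (?B i) \<omega>)"
    by (rule distr_cong_AE)
      (use AE assms in \<open>auto simp: UNIV_bool add.commute intro!: measurable_scattered borel_measurable_add\<close>)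
  then show "char (distr M borel (\<Lambda> (A \<union> B))) u =
      char (distr M borel (\<Lambda> A)) u * char (distr M borel (\<Lambda> B)) u"
    using scattered_UN(2)[OF finite B disj, of "\<lambda>_. 1" u]
    by (simp add: UNIV_bool mult.commute)
qed

lemma measurable_step_integral [measurable]:
  assumes "step_function g" "A \<in> sets borel"
  shows "step_integral \<Lambda> A g \<in> borel_measurable M"
  unfolding step_integral_def
  by (intro borel_measurable_sum borel_measurable_times borel_measurable_const measurable_scattered)
    (use assms step_functionD in auto)

lemma step_integral_comp:
  assumes q: "finite (range q)" "\<And>z. q -` {z} \<in> sets borel"
    and bdd: "bounded {s. F (q s) \<noteq> 0}" and A: "A \<in> sets borel"
  shows "AE \<omega> in M. step_integral \<Lambda> A (\<lambda>s. F (q s)) \<omega> = (\<Sum>z\<in>range q. F z * \<Lambda> (A \<inter> q -` {z}) \<omega>)"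
proof -
  let ?R = "range (\<lambda>s. F (q s)) - {0}"
  let ?Z = "\<lambda>c. {z \<in> range q. F z = c}"
  have fin: "finite ?R"
    using q(1) by (auto simp: image_comp[symmetric, of F q, unfolded comp_def])
  have *: "AE \<omega> in M. \<Lambda> (A \<inter> (\<lambda>s. F (q s)) -` {c}) \<omega> = (\<Sum>z\<in>?Z c. \<Lambda> (A \<inter> q -` {z}) \<omega>)"
    if "c \<in> ?R" for c
  proof -
    have eq: "A \<inter> (\<lambda>s. F (q s)) -` {c} = (\<Union>z\<in>?Z c. A \<inter> q -` {z})" by auto
    show ?thesis unfolding eq
    proof (rule scattered_UN(1))
      show "bounded (A \<inter> q -` {z})" if "z \<in> ?Z c" for z
        by (rule bounded_subset[OF bdd]) (use that \<open>c \<in> ?R\<close> in auto)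
    qed (use q A in \<open>auto simp: disjoint_family_on_def\<close>)
  qed
  have "AE \<omega> in M. \<forall>c\<in>?R. \<Lambda> (A \<inter> (\<lambda>s. F (q s)) -` {c}) \<omega> = (\<Sum>z\<in>?Z c. \<Lambda> (A \<inter> q -` {z}) \<omega>)"
    by (subst AE_finite_all[OF fin]) (use * in blast)
  then show ?thesis
  proof eventually_elim
    case (elim \<omega>)
    have "step_integral \<Lambda> A (\<lambda>s. F (q s)) \<omega> = (\<Sum>c\<in>?R. c * (\<Sum>z\<in>?Z c. \<Lambda> (A \<inter> q -` {z}) \<omega>))"
      unfolding step_integral_def using elim by (intro sum.cong) auto
    also have "\<dots> = (\<Sum>c\<in>?R. \<Sum>z | z \<in> {z \<in> range q. F z \<noteq> 0} \<and> F z = c. F z * \<Lambda> (A \<inter> q -` {z}) \<omega>)"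
      unfolding sum_distrib_left by (intro sum.cong) auto
    also have "\<dots> = (\<Sum>z\<in>{z \<in> range q. F z \<noteq> 0}. F z * \<Lambda> (A \<inter> q -` {z}) \<omega>)"
      by (rule sum.group) (use q fin in auto)
    also have "\<dots> = (\<Sum>z\<in>range q. F z * \<Lambda> (A \<inter> q -` {z}) \<omega>)"
      by (rule sum.mono_neutral_left) (use q in auto)
    finally show ?case .
  qed
qed

lemma step_integral_add_cmult:
  assumes f: "step_function f" and g: "step_function g" and A: "A \<in> sets borel"
  shows "AE \<omega> in M. step_integral \<Lambda> A (\<lambda>s. f s + c * g s) \<omega> =
    step_integral \<Lambda> A f \<omega> + c * step_integral \<Lambda> A g \<omega>"
proof -
  define q where "q s = (f s, g s)" for s
  have "range q \<subseteq> range f \<times> range g" by (auto simp: q_def)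
  then have q1: "finite (range q)"
    by (rule finite_subset) (use step_functionD(1) f g in blast)
  have "q -` {z} = f -` {fst z} \<inter> g -` {snd z}" for z by (auto simp: q_def)
  then have q2: "q -` {z} \<in> sets borel" for z using step_functionD(3) f g by auto
  have "AE \<omega> in M. step_integral \<Lambda> A f \<omega> = (\<Sum>z\<in>range q. fst z * \<Lambda> (A \<inter> q -` {z}) \<omega>)"
    using step_integral_comp[OF q1 q2 _ A, of fst] step_functionD(4)[OF f] by (simp add: q_def)
  moreover have "AE \<omega> in M. step_integral \<Lambda> A g \<omega> = (\<Sum>z\<in>range q. snd z * \<Lambda> (A \<inter> q -` {z}) \<omega>)"
    using step_integral_comp[OF q1 q2 _ A, of snd] step_functionD(4)[OF g] by (simp add: q_def)
  moreover have "AE \<omega> in M. step_integral \<Lambda> A (\<lambda>s. f s + c * g s) \<omega> =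
      (\<Sum>z\<in>range q. (fst z + c * snd z) * \<Lambda> (A \<inter> q -` {z}) \<omega>)"
    using step_integral_comp[OF q1 q2 _ A, of "\<lambda>z. fst z + c * snd z"]
      step_functionD(4)[OF step_function_add_cmult[OF f g, of c]] by (simp add: q_def)
  ultimately show ?thesis
    by eventually_elim (simp add: sum_distrib_left distrib_right mult.assoc sum.distrib)
qed

lemma step_integral_Un:
  assumes g: "step_function g" and A: "A \<in> sets borel" "B \<in> sets borel" "A \<inter> B = {}"
  shows "AE \<omega> in M. step_integral \<Lambda> (A \<union> B) g \<omega> = step_integral \<Lambda> A g \<omega> + step_integral \<Lambda> B g \<omega>"
proof -
  have "AE \<omega> in M. \<forall>c\<in>range g - {0}. \<Lambda> ((A \<union> B) \<inter> g -` {c}) \<omega> =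
      \<Lambda> (A \<inter> g -` {c}) \<omega> + \<Lambda> (B \<inter> g -` {c}) \<omega>"
  proof (subst AE_finite_all)
    show "finite (range g - {0})" using step_functionD(1)[OF g] by simp
    have "AE \<omega> in M. \<Lambda> ((A \<union> B) \<inter> g -` {c}) \<omega> =
        \<Lambda> (A \<inter> g -` {c}) \<omega> + \<Lambda> (B \<inter> g -` {c}) \<omega>" if "c \<noteq> 0" for c
      unfolding Int_Un_distrib2
      by (rule scattered_Un) (use step_functionD[OF g] that A in auto)
    then show "\<forall>c\<in>range g - {0}. AE \<omega> in M. \<Lambda> ((A \<union> B) \<inter> g -` {c}) \<omega> =
        \<Lambda> (A \<inter> g -` {c}) \<omega> + \<Lambda> (B \<inter> g -` {c}) \<omega>" by blast
  qed
  then show ?thesis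
    by eventually_elim (simp add: step_integral_def distrib_left sum.distrib)
qed

end

section \<open>Characteristic functions\<close>

lemma emeasure_lborel_bounded: "bounded B \<Longrightarrow> emeasure lborel B \<noteq> (\<infinity> :: ennreal)"
  using emeasure_bounded_finite[of B] by simp

lemma (in prob_space) char_tendsto:
  assumes [measurable]: "\<And>n. Z n \<in> borel_measurable M" "Y \<in> borel_measurable M"
    and "AE \<omega> in M. (\<lambda>n. Z n \<omega>) \<longlonglongrightarrow> Y \<omega>"
  shows "(\<lambda>n. char (distr M borel (Z n)) u) \<longlonglongrightarrow> char (distr M borel Y) u"
proof -
  have "(\<lambda>n. CLINT \<omega>|M. iexp (u * Z n \<omega>)) \<longlonglongrightarrow> (CLINT \<omega>|M. iexp (u * Y \<omega>))"
  proof (rule integral_dominated_convergence[where w="\<lambda>_. 1"])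
    show "AE \<omega> in M. (\<lambda>n. iexp (u * Z n \<omega>)) \<longlonglongrightarrow> iexp (u * Y \<omega>)"
      using assms(3) by eventually_elim (intro tendsto_intros)
  qed auto
  then show ?thesis unfolding char_def by (simp add: integral_distr)
qed

text \<open>A Dynkin argument on half-open intervals, carried out inside a window
  \<open>{-N<..N}\<close> because \<open>\<Lambda>\<close> is controlled on bounded sets only.
  Complements work because an exponential never vanishes and can be cancelled; countable disjoint
  unions follow by passing to the limit in the characteristic functions.\<close>

lemma (in scattered_measure) char_scattered:
  assumes Ioc: "\<And>a b. a \<le> b \<Longrightarrow> char (distr M borel (\<Lambda> {a<..b})) u = exp (of_real (b - a) * z)"
    and B: "B \<in> sets borel" "bounded B"
  shows "char (distr M borel (\<Lambda> B)) u = exp (of_real (measure lborel B) * z)"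
proof -
  obtain N where N: "N > 0" "B \<subseteq> {-N<..N}"
  proof -
    obtain N where "N > 0" "\<And>x. x \<in> B \<Longrightarrow> norm x < N" using B(2) bounded_pos_less by blast
    then show ?thesis by (intro that[of N]) (auto simp: abs_less_iff, fastforce+)
  qed
  let ?\<Omega> = "{-N<..N}"
  have bdd: "bounded (C \<inter> ?\<Omega>)" for C
    by (rule bounded_subset[OF bounded_closed_interval[of "-N" N]]) auto
  define Q where "Q C \<longleftrightarrow> char (distr M borel (\<Lambda> (C \<inter> ?\<Omega>))) u =
    exp (of_real (measure lborel (C \<inter> ?\<Omega>)) * z)" for C
  let ?G = "range (\<lambda>(a, b). {a<..b :: real})"
  have borel: "sets borel = sigma_sets UNIV ?G"
    using arg_cong[OF borel_sigma_sets_Ioc, of sets] by simp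
  have empty: "Q {}"
    using Ioc[of 0 0] by (simp add: Q_def)
  have "Q B"
  proof (rule sigma_sets_induct_disjoint[of ?G UNIV])
    show "Int_stable ?G"
    proof (rule Int_stableI)
      fix a b assume "a \<in> ?G" "b \<in> ?G"
      then obtain x y x' y' where "a = {x<..y}" "b = {x'<..y'}" by auto
      then have "a \<inter> b = {max x x'<..min y y'}" by auto
      then show "a \<inter> b \<in> ?G" by auto
    qed
    show "B \<in> sigma_sets UNIV ?G" using B(1) borel by simp
    show "Q A" if A: "A \<in> ?G" for A
    proof -
      obtain a b where "A = {a<..b}" using A by auto
      then have A: "A \<inter> ?\<Omega> = {max a (-N)<..min b N}" by auto
      show ?thesis
      proof (cases "max a (-N) \<le> min b N")
        case True
        then show ?thesis using Ioc[OF True] unfolding Q_def A by simp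
      next
        case False
        then have "A \<inter> ?\<Omega> = {}" unfolding A by (intro greaterThanAtMost_empty) linarith
        then show ?thesis using empty unfolding Q_def by simp
      qed
    qed
    show "Q {}" by fact
    show "Q (UNIV - A)" if A': "A \<in> sigma_sets UNIV ?G" and A: "Q A" for A
    proof -
      have [measurable]: "A \<in> sets borel" using A' borel by simp
      have U: "(A \<inter> ?\<Omega>) \<union> ((UNIV - A) \<inter> ?\<Omega>) = ?\<Omega>" by auto
      have "exp (of_real (2 * N) * z) = char (distr M borel (\<Lambda> ?\<Omega>)) u"
        using Ioc[of "-N" N] N by simp
      also have "\<dots> = char (distr M borel (\<Lambda> (A \<inter> ?\<Omega>))) u *
          char (distr M borel (\<Lambda> ((UNIV - A) \<inter> ?\<Omega>))) u"
        by (subst scattered_Un(2)[symmetric]) (auto intro: bdd simp: U)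
      also have "char (distr M borel (\<Lambda> (A \<inter> ?\<Omega>))) u = exp (of_real (measure lborel (A \<inter> ?\<Omega>)) * z)"
        using A by (simp add: Q_def)
      finally have 1: "exp (of_real (2 * N) * z) =
        exp (of_real (measure lborel (A \<inter> ?\<Omega>)) * z) * char (distr M borel (\<Lambda> ((UNIV - A) \<inter> ?\<Omega>))) u" .
      have "measure lborel ?\<Omega> = measure lborel (A \<inter> ?\<Omega>) + measure lborel ((UNIV - A) \<inter> ?\<Omega>)"
        by (subst measure_Union[symmetric]) (use U emeasure_lborel_bounded[OF bdd] in auto)
      then have "2 * N = measure lborel (A \<inter> ?\<Omega>) + measure lborel ((UNIV - A) \<inter> ?\<Omega>)"
        using N by simp
      then have "exp (of_real (2 * N) * z) = exp (of_real (measure lborel (A \<inter> ?\<Omega>)) * z) *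
          exp (of_real (measure lborel ((UNIV - A) \<inter> ?\<Omega>)) * z)"
        by (simp add: exp_add[symmetric] distrib_right[symmetric] del: of_real_mult)
      with 1 show ?thesis unfolding Q_def by simp
    qed
    show "Q (\<Union>i. A i)" if dA: "disjoint_family A" and A': "range A \<subseteq> sigma_sets UNIV ?G"
      and A: "\<And>i. Q (A i)" for A :: "nat \<Rightarrow> real set"
    proof -
      have [measurable]: "A i \<in> sets borel" for i using A' borel by auto
      let ?A = "\<lambda>i. A i \<inter> ?\<Omega>"
      have U: "(\<Union>i. A i) \<inter> ?\<Omega> = (\<Union>i. ?A i)" by auto
      have dA': "disjoint_family ?A" using dA by (auto simp: disjoint_family_on_def)
      have bU: "bounded (\<Union>i. ?A i)" unfolding U[symmetric] by (rule bdd)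
      have [measurable]: "\<Lambda> (?A i) \<in> borel_measurable M" "\<Lambda> (\<Union>i. ?A i) \<in> borel_measurable M" for i
        using bU bdd by (auto intro!: measurable_scattered)
      have "(\<lambda>n. char (distr M borel (\<lambda>\<omega>. \<Sum>i<n. 1 * \<Lambda> (?A i) \<omega>)) u) \<longlonglongrightarrow>
          char (distr M borel (\<Lambda> (\<Union>i. ?A i))) u"
        by (rule char_tendsto)
          (use sums_scattered[OF _ dA' bU] in \<open>auto simp: sums_def intro!: measurable_scattered bdd\<close>)
      moreover have "char (distr M borel (\<lambda>\<omega>. \<Sum>i<n. 1 * \<Lambda> (?A i) \<omega>)) u =
          exp (of_real (\<Sum>i<n. measure lborel (?A i)) * z)" for n
        using A dA' by (subst scattered_UN(2))
          (auto simp: Q_def bdd exp_sum sum_distrib_right disjoint_family_on_def)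
      moreover have "(\<lambda>n. exp (of_real (\<Sum>i<n. measure lborel (?A i)) * z)) \<longlonglongrightarrow>
          exp (of_real (measure lborel (\<Union>i. ?A i)) * z)"
      proof -
        have "(\<lambda>i. measure lborel (?A i)) sums measure lborel (\<Union>i. ?A i)"
          by (rule measure_UNION) (use dA' emeasure_lborel_bounded[OF bU] in auto)
        then show ?thesis unfolding sums_def by (intro tendsto_intros)
      qed
      ultimately show ?thesis unfolding Q_def U by (auto intro: LIMSEQ_unique)
    qed
  qed auto
  with N show ?thesis by (simp add: Q_def Int_absorb2)
qed

text \<open>The uniqueness argument rests on two features of the exponent: continuity bounds it on
  bounded intervals, and together with the value 0 at 0 it makes it small near 0.\<close>

locale levy_basis = scattered_measure +
  fixes \<psi> :: "real \<Rightarrow> complex"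
  assumes char_Ioc: "a \<le> b \<Longrightarrow> char (distr M borel (\<Lambda> {a<..b})) u = exp (of_real (b - a) * \<psi> u)"
    and exponent_continuous: "continuous_on UNIV \<psi>"
    and exponent_zero: "\<psi> 0 = 0"
begin

text \<open>A monotone majorant of the exponent: bounds on the values of a step function become
  bounds on its characteristic function.\<close>

definition bound_exponent :: "real \<Rightarrow> real" where
  "bound_exponent x = (SUP y\<in>{-x..x}. norm (\<psi> y))"

lemma bdd_above_exponent: "bdd_above ((\<lambda>y. norm (\<psi> y)) ` {-x..x})"
  by (intro bounded_imp_bdd_above compact_imp_bounded compact_continuous_image continuous_intros
      continuous_on_subset[OF exponent_continuous]) auto

lemma norm_exponent_le: "\<bar>y\<bar> \<le> x \<Longrightarrow> norm (\<psi> y) \<le> bound_exponent x"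
  unfolding bound_exponent_def by (rule cSUP_upper[OF _ bdd_above_exponent]) auto

lemma bound_exponent_nonneg: "x \<ge> 0 \<Longrightarrow> bound_exponent x \<ge> 0"
  using norm_exponent_le[of 0 x] exponent_zero by simp

lemma bound_exponent_mono: "0 \<le> x \<Longrightarrow> x \<le> y \<Longrightarrow> bound_exponent x \<le> bound_exponent y"
  unfolding bound_exponent_def by (rule cSUP_subset_mono[OF _ bdd_above_exponent]) auto

lemma bound_exponent_small:
  assumes "e > 0"
  obtains x where "x > 0" "bound_exponent x \<le> e"
proof -
  have "isCont \<psi> 0" using exponent_continuous by (simp add: continuous_on_eq_continuous_at)
  then obtain d where d: "d > 0" "\<And>y. \<bar>y\<bar> < d \<Longrightarrow> norm (\<psi> y) < e"
    using assms unfolding continuous_at_eps_delta by (force simp: exponent_zero)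
  have "bound_exponent (d / 2) \<le> e"
    unfolding bound_exponent_def
  proof (rule cSUP_least)
    show "norm (\<psi> y) \<le> e" if "y \<in> {- (d / 2)..d / 2}" for y
      using that d(1) by (intro less_imp_le d(2)) auto
  qed (use d in auto)
  with d(1) show ?thesis by (intro that[of "d / 2"]) auto
qed

lemma char_step_integral:
  assumes g: "step_function g" and A: "A \<in> sets borel"
  shows "char (distr M borel (step_integral \<Lambda> A g)) u =
    exp (\<Sum>c\<in>range g - {0}. of_real (measure lborel (A \<inter> g -` {c})) * \<psi> (u * c))"
proof -
  have fin: "finite (range g - {0})" using step_functionD(1)[OF g] by simp
  have "char (distr M borel (step_integral \<Lambda> A g)) u =
      (\<Prod>c\<in>range g - {0}. char (distr M borel (\<Lambda> (A \<inter> g -` {c}))) (u * c))"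
    unfolding step_integral_def
    by (rule scattered_UN(2)[OF fin])
      (use step_functionD[OF g] A in \<open>auto simp: disjoint_family_on_def\<close>)
  also have "\<dots> = (\<Prod>c\<in>range g - {0}. exp (of_real (measure lborel (A \<inter> g -` {c})) * \<psi> (u * c)))"
    by (intro prod.cong refl char_scattered[OF char_Ioc]) (use step_functionD[OF g] A in auto)
  also have "\<dots> = exp (\<Sum>c\<in>range g - {0}. of_real (measure lborel (A \<inter> g -` {c})) * \<psi> (u * c))"
    using fin by (simp add: exp_sum)
  finally show ?thesis .
qed

text \<open>The characteristic function at \<open>u\<close> is the exponential of a sum bounded by
  the measure of \<open>P n\<close> times \<open>bound_exponent (\<bar>u\<bar> * \<eta> n)\<close>.
  Replacing \<open>\<bar>u\<bar>\<close> by \<open>n\<close>, which eventually exceeds it, lets a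
  single hypothesis serve all \<open>u\<close>.\<close>

lemma step_integral_tendsto_zero:
  assumes g: "\<And>n. step_function (g n)"
    and P: "\<And>n. P n \<in> sets borel" "\<And>n. bounded (P n)"
    and le: "\<And>n s. s \<in> P n \<Longrightarrow> \<bar>g n s\<bar> \<le> \<eta> n" and \<eta>: "\<And>n. \<eta> n \<ge> 0"
    and lim: "(\<lambda>n. measure lborel (P n) * bound_exponent (real n * \<eta> n)) \<longlonglongrightarrow> 0"
  shows "tendsto_in_prob M (\<lambda>n. step_integral \<Lambda> (P n) (g n)) (\<lambda>_. 0)"
proof (rule tendsto_in_prob_zero_if_char)
  show "step_integral \<Lambda> (P n) (g n) \<in> borel_measurable M" for n
    using g P(1) by (rule measurable_step_integral)
  fix u :: real
  let ?z = "\<lambda>n. \<Sum>c\<in>range (g n) - {0}. of_real (measure lborel (P n \<inter> g n -` {c})) * \<psi> (u * c)"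
  have bnd: "norm (?z n) \<le> measure lborel (P n) * bound_exponent (real n * \<eta> n)"
    if n: "real n \<ge> \<bar>u\<bar>" for n
  proof -
    let ?R = "range (g n) - {0}"
    have "norm (?z n) \<le> (\<Sum>c\<in>?R. measure lborel (P n \<inter> g n -` {c}) * bound_exponent (real n * \<eta> n))"
    proof (rule sum_norm_le)
      fix c assume c: "c \<in> ?R"
      show "norm (of_real (measure lborel (P n \<inter> g n -` {c})) * \<psi> (u * c)) \<le>
          measure lborel (P n \<inter> g n -` {c}) * bound_exponent (real n * \<eta> n)"
      proof (cases "P n \<inter> g n -` {c} = {}")
        case False
        then have "\<bar>c\<bar> \<le> \<eta> n" using le by auto
        then have "\<bar>u * c\<bar> \<le> real n * \<eta> n"
          using n by (auto simp: abs_mult intro: mult_mono)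
        then show ?thesis
          by (auto simp: norm_mult intro!: mult_left_mono norm_exponent_le)
      qed simp
    qed
    also have "\<dots> = (\<Sum>c\<in>?R. measure lborel (P n \<inter> g n -` {c})) * bound_exponent (real n * \<eta> n)"
      by (simp add: sum_distrib_right)
    also have "(\<Sum>c\<in>?R. measure lborel (P n \<inter> g n -` {c})) = measure lborel (\<Union>c\<in>?R. P n \<inter> g n -` {c})"
    proof (rule measure_finite_Union[symmetric])
      have "bounded (P n \<inter> g n -` {c})" for c by (rule bounded_subset[OF P(2)]) auto
      from emeasure_lborel_bounded[OF this]
      show "emeasure lborel (P n \<inter> g n -` {c}) \<noteq> \<infinity>" for c by simp
    qed (use step_functionD(1,3)[OF g] P in \<open>auto simp: disjoint_family_on_def\<close>)
    also have "\<dots> \<le> measure lborel (P n)"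
    proof (rule measure_mono_fmeasurable)
      show "P n \<in> fmeasurable lborel"
        using P emeasure_lborel_bounded[OF P(2)] by (auto simp: fmeasurable_def less_top[symmetric])
      show "(\<Union>c\<in>?R. P n \<inter> g n -` {c}) \<in> sets lborel"
        using step_functionD(1,3)[OF g[of n]] P by (auto intro!: sets.finite_UN)
    qed auto
    finally show ?thesis
      using bound_exponent_nonneg[of "real n * \<eta> n"] \<eta>[of n] by (simp add: mult_right_mono)
  qed
  have "?z \<longlonglongrightarrow> 0"
  proof (rule Lim_null_comparison[OF _ lim])
    show "\<forall>\<^sub>F n in sequentially. norm (?z n) \<le> measure lborel (P n) * bound_exponent (real n * \<eta> n)"
      using eventually_ge_at_top[of "nat \<lceil>\<bar>u\<bar>\<rceil>"] by eventually_elim (rule bnd, linarith)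
  qed
  then have "(\<lambda>n. exp (?z n)) \<longlonglongrightarrow> exp 0" by (rule tendsto_exp)
  then show "(\<lambda>n. char (distr M borel (step_integral \<Lambda> (P n) (g n))) u) \<longlonglongrightarrow> 1"
    using char_step_integral[OF g P(1)] by simp
qed

end

section \<open>Uniqueness of the integral\<close>

text \<open>Boundedness of \<open>B\<close> makes \<open>indicator B\<close> an integrable majorant,
  so dominated convergence applies; on sets of infinite measure the conclusion may fail.\<close>

lemma tendsto_in_measure_bounded:
  fixes g :: "nat \<Rightarrow> real \<Rightarrow> real"
  assumes [measurable]: "\<And>n. g n \<in> borel_measurable borel" "B \<in> sets borel" and B: "bounded B"
    and lim: "AE s in lborel. (\<lambda>n. g n s) \<longlonglongrightarrow> 0" and e: "e > 0"
  shows "(\<lambda>n. measure lborel {s \<in> B. \<bar>g n s\<bar> > e}) \<longlonglongrightarrow> 0"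
proof -
  let ?S = "\<lambda>n. {s \<in> B. \<bar>g n s\<bar> > e}"
  have fin: "emeasure lborel B < \<infinity>"
    using emeasure_lborel_bounded[OF B] by (simp add: less_top[symmetric])
  have "(\<lambda>n. LINT s|lborel. indicator (?S n) s :: real) \<longlonglongrightarrow> (LINT s::real|lborel. (0 :: real))"
  proof (rule integral_dominated_convergence[where w="indicator B"])
    show "AE s in lborel. (\<lambda>n. indicator (?S n) s :: real) \<longlonglongrightarrow> 0"
      using lim
    proof eventually_elim
      case (elim s)
      have "\<forall>\<^sub>F n in sequentially. \<bar>g n s\<bar> < e"
        using order_tendstoD(2)[OF tendsto_rabs_zero[OF elim] e] .
      then have "\<forall>\<^sub>F n in sequentially. (0::real) = indicator (?S n) s"
        by eventually_elim (auto simp: indicator_def)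
      then show ?case by (rule Lim_transform_eventually[OF tendsto_const])
    qed
    show "integrable lborel (indicator B :: real \<Rightarrow> real)"
      using fin by (simp add: integrable_indicator_iff)
  qed (auto simp: indicator_def)
  then show ?thesis by simp
qed

text \<open>A gliding hump: along a subsequence, the \<open>j\<close>-th function is essentially carried by a set
  \<open>F j\<close>, and the \<open>F j\<close> are essentially disjoint. The integrals over the union of the even \<open>F j\<close>
  then tend to \<open>0\<close> along odd indices, and those over the complement along even indices.\<close>

lemma (in levy_basis) step_integral_null_subsequence:
  assumes g: "\<And>n. step_function (g n)"
    and lim: "AE s in lborel. (\<lambda>n. g n s) \<longlonglongrightarrow> 0"
    and cauchy: "\<And>A a b. A \<in> sets borel \<Longrightarrow> strict_mono a \<Longrightarrow> strict_mono b \<Longrightarrow>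
      tendsto_in_prob M (\<lambda>k \<omega>. step_integral \<Lambda> A (g (a k)) \<omega> - step_integral \<Lambda> A (g (b k)) \<omega>) (\<lambda>_. 0)"
  obtains r where "strict_mono r" "tendsto_in_prob M (\<lambda>k. step_integral \<Lambda> UNIV (g (r k))) (\<lambda>_. 0)"
proof -
  note [measurable] = step_functionD(2)[OF g]
  have "\<exists>r\<ge>0. \<forall>s. g n s \<noteq> 0 \<longrightarrow> \<bar>s\<bar> \<le> r" for n
    using step_functionD(4)[OF g[of n]] unfolding bounded_pos by (auto intro: less_imp_le)
  then obtain rad0 where rad0: "\<And>n. rad0 n \<ge> 0" "\<And>n s. g n s \<noteq> 0 \<Longrightarrow> \<bar>s\<bar> \<le> rad0 n" by metis
  \<comment> \<open>Summing the radii makes \<open>rad\<close> monotone, and \<open>rad m\<close>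
    then serves all \<open>g i\<close> with \<open>i \<le> m\<close> at once. The same device gives
    \<open>\<Gamma>\<close> for the sizes.\<close>
  define rad where "rad m = (\<Sum>i\<le>m. rad0 i)" for m :: nat
  have rad: "g i s \<noteq> 0 \<Longrightarrow> i \<le> m \<Longrightarrow> \<bar>s\<bar> \<le> rad m" and rad_nonneg: "rad m \<ge> 0" for i m s
  proof -
    show "rad m \<ge> 0" unfolding rad_def by (intro sum_nonneg rad0)
    assume "g i s \<noteq> 0" "i \<le> m"
    then have "\<bar>s\<bar> \<le> rad0 i" "rad0 i \<le> rad m"
      unfolding rad_def using rad0 by (auto intro!: member_le_sum)
    then show "\<bar>s\<bar> \<le> rad m" by simp
  qed
  have "\<exists>r\<ge>0. \<forall>s. \<bar>g n s\<bar> \<le> r" for n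
    using finite_imp_bounded[OF step_functionD(1)[OF g[of n]]] unfolding bounded_pos
    by (auto intro: less_imp_le)
  then obtain \<Gamma>0 where \<Gamma>0: "\<And>n. \<Gamma>0 n \<ge> 0" "\<And>n s. \<bar>g n s\<bar> \<le> \<Gamma>0 n" by metis
  define \<Gamma> where "\<Gamma> m = (\<Sum>i\<le>m. \<Gamma>0 i)" for m :: nat
  have \<Gamma>: "\<bar>g m s\<bar> \<le> \<Gamma> m" and \<Gamma>_nonneg: "\<Gamma> m \<ge> 0" for m s
  proof -
    show "\<Gamma> m \<ge> 0" unfolding \<Gamma>_def by (intro sum_nonneg \<Gamma>0)
    have "\<Gamma>0 m \<le> \<Gamma> m" unfolding \<Gamma>_def using \<Gamma>0 by (auto intro!: member_le_sum)
    with \<Gamma>0(2)[of m s] show "\<bar>g m s\<bar> \<le> \<Gamma> m" by simp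
  qed
  have \<Gamma>_mono: "\<Gamma> m \<le> \<Gamma> m'" if "m \<le> m'" for m m'
    unfolding \<Gamma>_def using \<Gamma>0 that by (intro sum_mono2) auto
  \<comment> \<open>The threshold for small values: on the window of length
    \<open>2 * rad m\<close>, a function bounded by \<open>\<eta> m\<close> contributes at most
    \<open>(1/2) ^ m\<close> to the exponent, for arguments up to \<open>m\<close>.\<close>
  have "\<exists>\<eta>>0. 2 * rad m * bound_exponent (real m * \<eta>) \<le> (1/2) ^ m" for m
  proof -
    obtain x where x: "x > 0" "bound_exponent x \<le> (1/2) ^ m / (2 * rad m + 1)"
      using bound_exponent_small[of "(1/2) ^ m / (2 * rad m + 1)"] rad_nonneg[of m] by auto
    have "bound_exponent (real m * (x / (real m + 1))) \<le> bound_exponent x"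
      using x by (intro bound_exponent_mono) (auto simp: field_simps)
    also note x(2)
    finally have "2 * rad m * bound_exponent (real m * (x / (real m + 1))) \<le>
        2 * rad m * ((1/2) ^ m / (2 * rad m + 1))"
      using rad_nonneg[of m] by (intro mult_left_mono) auto
    also have "\<dots> = (1/2) ^ m * (2 * rad m / (2 * rad m + 1))" by simp
    also have "\<dots> \<le> (1/2) ^ m * 1"
      using rad_nonneg[of m] by (intro mult_left_mono) auto
    finally show ?thesis using x(1) by (intro exI[of _ "x / (real m + 1)"]) auto
  qed
  then obtain \<eta> where \<eta>: "\<And>m. \<eta> m > 0"
    "\<And>m. 2 * rad m * bound_exponent (real m * \<eta> m) \<le> (1/2) ^ m" by metis
  \<comment> \<open>The largest contribution per unit of measure that \<open>g m\<close> can make to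
    the exponent, again for arguments up to \<open>m\<close>. A set of measure
    \<open>(1/2) ^ m / \<kappa> m\<close> is thus negligible for \<open>g m\<close>; the summand 1
    permits the division.\<close>
  define \<kappa> where "\<kappa> m = 1 + bound_exponent (real m * \<Gamma> m)" for m
  have \<kappa>: "\<kappa> m \<ge> 1" for m
    using \<Gamma>_nonneg by (auto simp: \<kappa>_def intro!: bound_exponent_nonneg)
  have \<kappa>_mono: "\<kappa> m \<le> \<kappa> m'" if "m \<le> m'" for m m'
    unfolding \<kappa>_def using that \<Gamma>_mono[OF that] \<Gamma>_nonneg
    by (auto intro!: bound_exponent_mono mult_mono)
  \<comment> \<open>From index \<open>N m\<close> on, the functions exceed the threshold of stage
    \<open>m\<close> inside the window only on a set negligible for \<open>g m\<close>.\<close>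
  have "\<exists>N>m. \<forall>p\<ge>N. measure lborel {s \<in> {-rad m..rad m}. \<bar>g p s\<bar> > \<eta> m} \<le> (1/2) ^ m / \<kappa> m" for m
  proof -
    have "(\<lambda>p. measure lborel {s \<in> {-rad m..rad m}. \<bar>g p s\<bar> > \<eta> m}) \<longlonglongrightarrow> 0"
      by (rule tendsto_in_measure_bounded[OF _ _ _ lim \<eta>(1)]) auto
    moreover have "(1/2) ^ m / \<kappa> m > 0" using \<kappa>[of m] by simp
    ultimately have "\<forall>\<^sub>F p in sequentially.
        measure lborel {s \<in> {-rad m..rad m}. \<bar>g p s\<bar> > \<eta> m} < (1/2) ^ m / \<kappa> m"
      by (rule order_tendstoD(2))
    then obtain N where "\<And>p. p \<ge> N \<Longrightarrow>
        measure lborel {s \<in> {-rad m..rad m}. \<bar>g p s\<bar> > \<eta> m} < (1/2) ^ m / \<kappa> m"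
      by (auto simp: eventually_sequentially)
    then show ?thesis by (intro exI[of _ "max N (Suc m)"]) (auto intro: less_imp_le)
  qed
  then obtain N where N: "\<And>m. N m > m" "\<And>m p. p \<ge> N m \<Longrightarrow>
    measure lborel {s \<in> {-rad m..rad m}. \<bar>g p s\<bar> > \<eta> m} \<le> (1/2) ^ m / \<kappa> m" by metis
  define n where "n j = (N ^^ j) 0" for j
  have n_Suc: "n (Suc j) = N (n j)" for j by (simp add: n_def)
  have n: "strict_mono n" unfolding strict_mono_Suc_iff n_Suc using N by simp
  have n_ge: "j \<le> n j" for j using n by (rule seq_suble)
  have n_mono: "i \<le> j \<Longrightarrow> n i \<le> n j" for i j using n by (simp add: strict_mono_less_eq)

  \<comment> \<open>\<open>G j\<close> has index \<open>n (Suc j)\<close>, one step ahead of its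
    window \<open>B j\<close> and threshold \<open>\<eta> (n j)\<close>: these are fixed before the
    function is chosen.\<close>
  define G where "G j = g (n (Suc j))" for j
  define B where "B j = {- rad (n j)..rad (n j)}" for j
  define P where "P j = {s \<in> B j. \<bar>G j s\<bar> \<le> \<eta> (n j)}" for j
  \<comment> \<open>The hump: the part of the support where \<open>G j\<close> is large or which
    lies outside the window.\<close>
  define F where "F j = {s. G j s \<noteq> 0} - P j" for j
  define U where "U j = (\<Union>m\<in>{j<..}. F m)" for j
  define A where "A = (\<Union>j\<in>{j. even j}. F j - U j)"
  \<comment> \<open>\<open>C j\<close> meets the hump \<open>F j\<close> only within later humps:
    for odd \<open>j\<close> because \<open>A\<close> is built from even humps cleared of all later
    ones, for even \<open>j\<close> because \<open>A\<close> contains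
    \<open>F j - U j\<close>.\<close>
  define C where "C j = (if odd j then A else - A)" for j :: nat
  define Q where "Q j = {s. G j s \<noteq> 0} \<inter> U j" for j
  have G: "step_function (G j)" for j by (simp add: G_def g)
  have [measurable]: "G j \<in> borel_measurable borel" for j unfolding G_def by simp
  have [measurable]: "B j \<in> sets borel" for j by (simp add: B_def)
  have [measurable]: "P j \<in> sets borel" for j unfolding P_def by measurable
  have [measurable]: "F j \<in> sets borel" for j unfolding F_def by measurable
  have [measurable]: "U j \<in> sets borel" for j unfolding U_def by measurable
  have [measurable]: "A \<in> sets borel" unfolding A_def by measurable
  have [measurable]: "C j \<in> sets borel" for j by (cases "odd j") (simp_all add: C_def)
  have [measurable]: "Q j \<in> sets borel" for j unfolding Q_def by measurable
  \<comment> \<open>The support of \<open>G j\<close> lies in all later windows, so a later hump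
    matters for it only inside its own window, where it is small.\<close>
  have supp: "{s. G j s \<noteq> 0} \<subseteq> B m" if "j < m" for j m
    using rad[of "n (Suc j)" _ "n m"] n_mono[of "Suc j" m] that by (auto simp: G_def B_def abs_le_iff, fastforce+)
  have C_sub: "C j \<inter> {s. G j s \<noteq> 0} \<subseteq> P j \<union> Q j" for j
  proof
    fix s assume s: "s \<in> C j \<inter> {s. G j s \<noteq> 0}"
    have "s \<in> U j" if "s \<notin> P j"
    proof (cases "odd j")
      case True
      with s obtain k where k: "even k" "s \<in> F k" "s \<notin> U k" by (auto simp: C_def A_def)
      have "s \<in> F j" using s that by (simp add: F_def)
      with k True have "\<not> k < j" "k \<noteq> j" by (auto simp: U_def)
      with k show ?thesis by (auto simp: U_def)
    next
      case False
      then have "s \<notin> F j - U j" using s by (auto simp: C_def A_def)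
      with s that show ?thesis by (simp add: F_def)
    qed
    with s show "s \<in> P j \<union> Q j" by (auto simp: Q_def)
  qed
  have F_small: "emeasure lborel (F m \<inter> B m) \<le> ennreal ((1/2) ^ n m / \<kappa> (n m))" for m
  proof -
    have "F m \<inter> B m \<subseteq> {s \<in> B m. \<bar>G m s\<bar> > \<eta> (n m)}" by (auto simp: F_def P_def)
    then have "emeasure lborel (F m \<inter> B m) \<le> emeasure lborel {s \<in> B m. \<bar>G m s\<bar> > \<eta> (n m)}"
      by (rule emeasure_mono) measurable
    also have "\<dots> = ennreal (measure lborel {s \<in> B m. \<bar>G m s\<bar> > \<eta> (n m)})"
    proof (rule emeasure_eq_ennreal_measure)
      have "bounded {s \<in> B m. \<bar>G m s\<bar> > \<eta> (n m)}"
        by (rule bounded_subset[OF bounded_closed_interval[of "- rad (n m)" "rad (n m)"]])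
          (auto simp: B_def)
      from emeasure_lborel_bounded[OF this]
      show "emeasure lborel {s \<in> B m. \<bar>G m s\<bar> > \<eta> (n m)} \<noteq> top" by simp
    qed
    also have "\<dots> \<le> ennreal ((1/2) ^ n m / \<kappa> (n m))"
      using N(2)[of "n m" "n (Suc m)"] by (intro ennreal_leI) (simp add: B_def G_def n_Suc)
    finally show ?thesis .
  qed
  \<comment> \<open>Monotonicity of \<open>\<kappa>\<close> allows every later hump to be measured
    against \<open>\<kappa> (n (Suc j))\<close>, the bound belonging to \<open>G j\<close> itself.
    The factors \<open>(1/2) ^ m\<close> for \<open>m > j\<close> sum to
    \<open>(1/2) ^ j\<close>.\<close>
  have Q_small: "measure lborel (Q j) \<le> (1/2) ^ j / \<kappa> (n (Suc j))" for j
  proof -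
    let ?c = "(1/2) ^ j / \<kappa> (n (Suc j))"
    have c: "?c \<ge> 0" using \<kappa>[of "n (Suc j)"] by simp
    have "Q j \<subseteq> (\<Union>i. F (Suc j + i) \<inter> B (Suc j + i))"
    proof
      fix s assume "s \<in> Q j"
      then obtain m where m: "m > j" "s \<in> F m" "G j s \<noteq> 0" by (auto simp: Q_def U_def)
      then have "s \<in> F (Suc j + (m - Suc j)) \<inter> B (Suc j + (m - Suc j))" using supp[of j m] by auto
      then show "s \<in> (\<Union>i. F (Suc j + i) \<inter> B (Suc j + i))" by blast
    qed
    then have "emeasure lborel (Q j) \<le> emeasure lborel (\<Union>i. F (Suc j + i) \<inter> B (Suc j + i))"
      by (rule emeasure_mono) measurable
    also have "\<dots> \<le> (\<Sum>i. emeasure lborel (F (Suc j + i) \<inter> B (Suc j + i)))"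
      by (rule emeasure_subadditive_countably) auto
    also have "\<dots> \<le> (\<Sum>i. ennreal (?c * (1/2) ^ Suc i))"
    proof (rule suminf_le)
      fix i
      let ?m = "Suc j + i"
      have "(1/2) ^ n ?m / \<kappa> (n ?m) \<le> (1/2::real) ^ ?m / \<kappa> (n (Suc j))"
        using \<kappa>[of "n (Suc j)"] \<kappa>_mono[OF n_mono[of "Suc j" ?m]] n_ge[of ?m]
        by (intro frac_le power_decreasing) auto
      also have "\<dots> = ?c * (1/2) ^ Suc i" by (simp add: power_add)
      finally show "emeasure lborel (F ?m \<inter> B ?m) \<le> ennreal (?c * (1/2) ^ Suc i)"
        using F_small[of ?m] ennreal_leI order_trans by blast
    qed auto
    also have "\<dots> = ennreal (?c * 1)"
      by (intro suminf_ennreal_eq sums_mult power_half_series) (use \<kappa>[of "n (Suc j)"] in auto)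
    finally show ?thesis
      using c by (simp add: measure_def enn2real_leI)
  qed

  \<comment> \<open>Small values on a window of controlled length; \<open>Q_lim\<close> is the
    opposite case, arbitrary values of \<open>G j\<close> on a set of tiny measure.\<close>
  have P_lim: "tendsto_in_prob M (\<lambda>j. step_integral \<Lambda> (C j \<inter> P j) (G j)) (\<lambda>_. 0)"
  proof (rule step_integral_tendsto_zero[OF G])
    show b: "bounded (C j \<inter> P j)" for j
      by (rule bounded_subset[OF bounded_closed_interval[of "- rad (n j)" "rad (n j)"]])
        (auto simp: B_def P_def)
    show "\<bar>G j s\<bar> \<le> \<eta> (n j)" if "s \<in> C j \<inter> P j" for j s using that by (simp add: P_def)
    show "\<eta> (n j) \<ge> 0" for j using \<eta>(1) less_imp_le by blast
    have "norm (measure lborel (C j \<inter> P j) * bound_exponent (real j * \<eta> (n j))) \<le> (1/2) ^ j" for j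
    proof -
      have "measure lborel (C j \<inter> P j) \<le> measure lborel (B j)"
        using emeasure_lborel_bounded[OF bounded_closed_interval[of "- rad (n j)" "rad (n j)"]]
        by (intro measure_mono_fmeasurable)
          (auto simp: P_def B_def fmeasurable_def less_top[symmetric])
      also have "\<dots> = 2 * rad (n j)" using rad_nonneg[of "n j"] by (simp add: B_def)
      finally have 1: "measure lborel (C j \<inter> P j) \<le> 2 * rad (n j)" .
      have "bound_exponent (real j * \<eta> (n j)) \<le> bound_exponent (real (n j) * \<eta> (n j))"
        using n_ge[of j] \<eta>(1)[of "n j"] by (intro bound_exponent_mono mult_right_mono) auto
      with 1 have "measure lborel (C j \<inter> P j) * bound_exponent (real j * \<eta> (n j)) \<le>
          2 * rad (n j) * bound_exponent (real (n j) * \<eta> (n j))"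
        using rad_nonneg[of "n j"] \<eta>(1)[of "n j"]
        by (intro mult_mono) (auto intro!: bound_exponent_nonneg)
      also have "\<dots> \<le> (1/2) ^ n j" by (rule \<eta>)
      also have "\<dots> \<le> (1/2) ^ j" using n_ge[of j] by (intro power_decreasing) auto
      finally show ?thesis
        using \<eta>(1)[of "n j"] bound_exponent_nonneg[of "real j * \<eta> (n j)"] by (simp add: abs_mult)
    qed
    then show "(\<lambda>j. measure lborel (C j \<inter> P j) * bound_exponent (real j * \<eta> (n j))) \<longlonglongrightarrow> 0"
      by (intro Lim_null_comparison[OF always_eventually LIMSEQ_power_zero[of "1/2"]]) auto
  qed auto
  have Q_lim: "tendsto_in_prob M (\<lambda>j. step_integral \<Lambda> (C j \<inter> Q j - P j) (G j)) (\<lambda>_. 0)"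
  proof (rule step_integral_tendsto_zero[OF G])
    have bQ: "bounded (Q j)" for j
      by (rule bounded_subset[OF step_functionD(4)[OF G[of j]]]) (auto simp: Q_def)
    then show "bounded (C j \<inter> Q j - P j)" for j by (rule bounded_subset) auto
    show "\<bar>G j s\<bar> \<le> \<Gamma> (n (Suc j))" for j s using \<Gamma> by (simp add: G_def)
    show "\<Gamma> (n (Suc j)) \<ge> 0" for j by (rule \<Gamma>_nonneg)
    have "norm (measure lborel (C j \<inter> Q j - P j) * bound_exponent (real j * \<Gamma> (n (Suc j)))) \<le> (1/2) ^ j" for j
    proof -
      have "measure lborel (C j \<inter> Q j - P j) \<le> measure lborel (Q j)"
        using emeasure_lborel_bounded[OF bQ[of j]]
        by (intro measure_mono_fmeasurable) (auto simp: fmeasurable_def less_top[symmetric])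
      also note Q_small
      finally have 1: "measure lborel (C j \<inter> Q j - P j) \<le> (1/2) ^ j / \<kappa> (n (Suc j))" .
      have "bound_exponent (real j * \<Gamma> (n (Suc j))) \<le> bound_exponent (real (n (Suc j)) * \<Gamma> (n (Suc j)))"
        using n_ge[of "Suc j"] \<Gamma>_nonneg[of "n (Suc j)"]
        by (intro bound_exponent_mono mult_right_mono) auto
      then have "bound_exponent (real j * \<Gamma> (n (Suc j))) \<le> \<kappa> (n (Suc j))" by (simp add: \<kappa>_def)
      with 1 have "measure lborel (C j \<inter> Q j - P j) * bound_exponent (real j * \<Gamma> (n (Suc j))) \<le>
          (1/2) ^ j / \<kappa> (n (Suc j)) * \<kappa> (n (Suc j))"
        using \<kappa>[of "n (Suc j)"] \<Gamma>_nonneg[of "n (Suc j)"]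
        by (intro mult_mono) (auto intro!: bound_exponent_nonneg)
      also have "\<dots> = (1/2) ^ j" using \<kappa>[of "n (Suc j)"] by simp
      finally show ?thesis
        using \<Gamma>_nonneg[of "n (Suc j)"] bound_exponent_nonneg[of "real j * \<Gamma> (n (Suc j))"]
        by (simp add: abs_mult)
    qed
    then show "(\<lambda>j. measure lborel (C j \<inter> Q j - P j) * bound_exponent (real j * \<Gamma> (n (Suc j)))) \<longlonglongrightarrow> 0"
      by (intro Lim_null_comparison[OF always_eventually LIMSEQ_power_zero[of "1/2"]]) auto
  qed auto
  have C_lim: "tendsto_in_prob M (\<lambda>j. step_integral \<Lambda> (C j) (G j)) (\<lambda>_. 0)"
  proof (rule tendsto_in_prob_cong_AE)
    show "tendsto_in_prob M (\<lambda>j \<omega>. step_integral \<Lambda> (C j \<inter> P j) (G j) \<omega> +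
        step_integral \<Lambda> (C j \<inter> Q j - P j) (G j) \<omega>) (\<lambda>_. 0)"
      using tendsto_in_prob_add[OF _ _ _ _ P_lim Q_lim] G by auto
    show "AE \<omega> in M. step_integral \<Lambda> (C j \<inter> P j) (G j) \<omega> +
        step_integral \<Lambda> (C j \<inter> Q j - P j) (G j) \<omega> = step_integral \<Lambda> (C j) (G j) \<omega>" for j
    proof -
      have eq: "((C j \<inter> P j) \<union> (C j \<inter> Q j - P j)) \<inter> {s. G j s \<noteq> 0} = C j \<inter> {s. G j s \<noteq> 0}"
        using C_sub[of j] by auto
      have "AE \<omega> in M. step_integral \<Lambda> ((C j \<inter> P j) \<union> (C j \<inter> Q j - P j)) (G j) \<omega> =
          step_integral \<Lambda> (C j \<inter> P j) (G j) \<omega> + step_integral \<Lambda> (C j \<inter> Q j - P j) (G j) \<omega>"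
        by (rule step_integral_Un[OF G]) auto
      then show ?thesis
        by eventually_elim (metis eq step_integral_support)
    qed
  qed (use G in auto)

  \<comment> \<open>By the index shift in \<open>G\<close>, \<open>g (a k)\<close> is
    \<open>G (2 * k + 1)\<close> and \<open>g (b k)\<close> is \<open>G (2 * k)\<close>: the
    integrals over \<open>A\<close> are controlled along \<open>a\<close>, those over
    \<open>- A\<close> along \<open>b\<close>.\<close>
  define a where "a k = n (2 * k + 2)" for k
  define b where "b k = n (2 * k + 1)" for k
  have ab: "strict_mono a" "strict_mono b"
    using n by (auto simp: a_def b_def strict_mono_def)
  have A_lim: "tendsto_in_prob M (\<lambda>k. step_integral \<Lambda> A (g (a k))) (\<lambda>_. 0)"
    using tendsto_in_prob_subseq[OF C_lim, of "\<lambda>k. 2 * k + 1"]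
    by (simp add: C_def G_def a_def strict_mono_def)
  have Ac_lim': "tendsto_in_prob M (\<lambda>k. step_integral \<Lambda> (- A) (g (b k))) (\<lambda>_. 0)"
    using tendsto_in_prob_subseq[OF C_lim, of "\<lambda>k. 2 * k"]
    by (simp add: C_def G_def b_def strict_mono_def)
  \<comment> \<open>The Cauchy hypothesis on the set \<open>- A\<close> carries the null limit from
    \<open>b\<close> over to \<open>a\<close>, so that both pieces of the line are controlled along
    the same subsequence.\<close>
  have "tendsto_in_prob M (\<lambda>k \<omega>. (step_integral \<Lambda> (- A) (g (a k)) \<omega> - step_integral \<Lambda> (- A) (g (b k)) \<omega>)
      + step_integral \<Lambda> (- A) (g (b k)) \<omega>) (\<lambda>_. 0 + 0)"
    by (rule tendsto_in_prob_add[OF _ _ _ _ cauchy[OF _ ab] Ac_lim']) (use g in auto)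
  then have "tendsto_in_prob M (\<lambda>k. step_integral \<Lambda> (- A) (g (a k))) (\<lambda>_. 0)" by simp
  from tendsto_in_prob_add[OF _ _ _ _ A_lim this]
  have *: "tendsto_in_prob M (\<lambda>k \<omega>. step_integral \<Lambda> A (g (a k)) \<omega> + step_integral \<Lambda> (- A) (g (a k)) \<omega>) (\<lambda>_. 0)"
    using g by auto
  have "tendsto_in_prob M (\<lambda>k. step_integral \<Lambda> UNIV (g (a k))) (\<lambda>_. 0)"
  proof (rule tendsto_in_prob_cong_AE[OF _ _ _ _ *])
    show "AE \<omega> in M. step_integral \<Lambda> A (g (a k)) \<omega> + step_integral \<Lambda> (- A) (g (a k)) \<omega> =
        step_integral \<Lambda> UNIV (g (a k)) \<omega>" for k
    proof -
      have "AE \<omega> in M. step_integral \<Lambda> (A \<union> - A) (g (a k)) \<omega> =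
          step_integral \<Lambda> A (g (a k)) \<omega> + step_integral \<Lambda> (- A) (g (a k)) \<omega>"
        by (rule step_integral_Un[OF g]) auto
      then show ?thesis by eventually_elim simp
    qed
  qed (use g in auto)
  with ab(1) show ?thesis by (rule that)
qed

section \<open>The random measure of a two-sided Levy process\<close>

text \<open>A first-order Taylor estimate for small jumps gives \<open>U\<^sup>2 / 2\<close>, the
  triangle inequality for large jumps gives 2; their common bound is the integrable majorant behind
  continuity of the exponent.\<close>

lemma norm_levy_integrand_le:
  assumes "\<bar>u\<bar> \<le> U"
  shows "cmod (iexp (u * x) - 1 - \<i> * u * x * of_real (indicator {-1..1} x)) \<le> (2 + U\<^sup>2) * min 1 (x\<^sup>2)"
proof (cases "\<bar>x\<bar> \<le> 1")
  case True
  have "cmod (iexp (u * x) - (\<Sum>k\<le>1. (\<i> * of_real (u * x)) ^ k / fact k)) \<le> \<bar>u * x\<bar> ^ Suc 1 / fact (Suc 1)"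
    by (rule iexp_approx1)
  then have "cmod (iexp (u * x) - 1 - \<i> * u * x) \<le> u\<^sup>2 * x\<^sup>2 / 2"
    by (simp add: power2_eq_square abs_mult algebra_simps)
  also have "u\<^sup>2 * x\<^sup>2 \<le> U\<^sup>2 * x\<^sup>2"
    using assms by (intro mult_right_mono) (auto simp: abs_le_square_iff[symmetric])
  then have "u\<^sup>2 * x\<^sup>2 / 2 \<le> (2 + U\<^sup>2) * x\<^sup>2"
    by (simp add: algebra_simps) (smt (verit) zero_le_power2 mult_nonneg_nonneg)
  finally show ?thesis
    using True by (simp add: indicator_def abs_le_iff min_absorb2 abs_square_le_1)
next
  case False
  have "cmod (iexp (u * x) - 1) \<le> 1 + 1"
    by (rule norm_triangle_le_diff) (simp add: norm_exp_i_times)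
  moreover have "min 1 (x\<^sup>2) = 1"
    using False abs_square_le_1[of x] by simp
  moreover have "indicator {-1..1} x = (0 :: real)"
    using False by (auto simp: indicator_def)
  ultimately show ?thesis by (simp add: add_increasing2)
qed

lemma levy_exponent_continuous:
  assumes "levy_measure \<nu>"
  shows "continuous_on UNIV (levy_exponent \<gamma> \<sigma> \<nu>)"
proof -
  have [measurable_cong]: "sets \<nu> = sets borel" and int: "integrable \<nu> (\<lambda>x. min 1 (x\<^sup>2))"
    using assms by (auto simp: levy_measure_def)
  have "continuous_on UNIV (\<lambda>u. CLINT x|\<nu>. iexp (u * x) - 1 - \<i> * u * x * of_real (indicator {-1..1} x))"
  proof (rule continuous_on_sequentiallyI)
    fix v :: "nat \<Rightarrow> real" and u assume v: "v \<longlonglongrightarrow> u"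
    then obtain U where U: "\<And>n. \<bar>v n\<bar> \<le> U"
      using convergent_imp_Bseq[of v] by (auto simp: convergent_def Bseq_def)
    show "(\<lambda>n. CLINT x|\<nu>. iexp (v n * x) - 1 - \<i> * v n * x * of_real (indicator {-1..1} x)) \<longlonglongrightarrow>
        (CLINT x|\<nu>. iexp (u * x) - 1 - \<i> * u * x * of_real (indicator {-1..1} x))"
    proof (rule integral_dominated_convergence[where w="\<lambda>x. (2 + U\<^sup>2) * min 1 (x\<^sup>2)"])
      show "AE x in \<nu>. (\<lambda>n. iexp (v n * x) - 1 - \<i> * v n * x * of_real (indicator {-1..1} x)) \<longlonglongrightarrow>
          iexp (u * x) - 1 - \<i> * u * x * of_real (indicator {-1..1} x)"
        by (intro AE_I2 tendsto_intros v)
      show "AE x in \<nu>. norm (iexp (v n * x) - 1 - \<i> * v n * x * of_real (indicator {-1..1} x)) \<le>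
          (2 + U\<^sup>2) * min 1 (x\<^sup>2)" for n
        using norm_levy_integrand_le[OF U] by (intro AE_I2)
      show "integrable \<nu> (\<lambda>x. (2 + U\<^sup>2) * min 1 (x\<^sup>2))"
        using int by simp
    qed measurable
  qed
  then show ?thesis
    unfolding levy_exponent_def by (intro continuous_intros) auto
qed

lemma levy_exponent_zero: "levy_exponent \<gamma> \<sigma> \<nu> 0 = 0"
  by (simp add: levy_exponent_def)

text \<open>Marginals are read off from the law on path space; this is how the second copy inherits
  the exponent of the first.\<close>

lemma distr_path_map:
  assumes "\<And>t. t \<ge> 0 \<Longrightarrow> X t \<in> borel_measurable M" "t \<ge> 0"
  shows "distr M borel (X t) = distr (distr M path_space (path_map X)) borel (\<lambda>f. f t)"
proof -
  have "path_map X \<in> measurable M path_space"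
    unfolding path_map_def using assms(1) by (intro measurable_restrict) auto
  then have "distr (distr M path_space (path_map X)) borel (\<lambda>f. f t) = distr M borel ((\<lambda>f. f t) \<circ> path_map X)"
    using assms(2) by (intro distr_distr measurable_component_singleton) auto
  also have "(\<lambda>f. f t) \<circ> path_map X = X t"
    using assms(2) by (auto simp: path_map_def fun_eq_iff)
  finally show ?thesis by simp
qed

text \<open>Intervals starting or ending at 0 are read off from the two one-sided processes. The
  others follow from multiplicativity over adjacent intervals: an interval on one side of 0 is a
  difference of two such intervals, and the nonvanishing exponential is cancelled.\<close>

lemma levy_basis_two_sided_levy_process:
  assumes "prob_space M" and L: "two_sided_levy_process M L \<gamma> \<sigma> \<nu>"
    and \<Lambda>: "levy_random_measure M L \<Lambda>"
  shows "levy_basis M \<Lambda> (levy_exponent \<gamma> \<sigma> \<nu>)"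
proof -
  interpret prob_space M by fact
  interpret scattered_measure M \<Lambda>
    using \<Lambda> by unfold_locales (simp add: levy_random_measure_def)
  define \<psi> where "\<psi> = levy_exponent \<gamma> \<sigma> \<nu>"
  have [measurable]: "L t \<in> borel_measurable M" for t
    using L by (auto simp: two_sided_levy_process_def)
  obtain L1 L2 where L1: "levy_process M L1" and triplet: "characteristic_triplet M L1 \<gamma> \<sigma> \<nu>"
    and L2: "levy_process M L2"
    and same: "distr M path_space (path_map L1) = distr M path_space (path_map L2)"
    and AE_L: "AE \<omega> in M. (\<forall>t\<ge>0. L t \<omega> = L1 t \<omega>) \<and>
      (\<forall>t<0. ((\<lambda>s. L2 s \<omega>) \<longlongrightarrow> - L t \<omega>) (at_left (- t)))"
    using L unfolding two_sided_levy_process_def by blast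
  have meas: "L1 t \<in> borel_measurable M" "L2 t \<in> borel_measurable M" if "t \<ge> 0" for t
    using L1 L2 that by (auto simp: levy_process_def)
  have char1: "char (distr M borel (L1 t)) u = exp (t * \<psi> u)" if "t \<ge> 0" for t u
    using triplet that by (auto simp: characteristic_triplet_def \<psi>_def)
  have char2: "char (distr M borel (L2 t)) u = exp (t * \<psi> u)" if "t \<ge> 0" for t u
  proof -
    have "distr M borel (L2 t) = distr M borel (L1 t)"
      using distr_path_map[of L1 M t] distr_path_map[of L2 M t] meas that same by simp
    then show ?thesis using char1[OF that] by simp
  qed
  have [measurable]: "\<Lambda> {a<..b} \<in> borel_measurable M" for a b
    by (rule measurable_scattered)
      (auto intro: bounded_subset[OF bounded_closed_interval[of a b]])
  have AE_0: "AE \<omega> in M. L1 0 \<omega> = 0" using L1 by (auto simp: levy_process_def)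
  have AE_\<Lambda>: "AE \<omega> in M. \<Lambda> {a<..b} \<omega> = L b \<omega> - L a \<omega>" if "a \<le> b" for a b
    using \<Lambda> that by (auto simp: levy_random_measure_def)
  have pos: "char (distr M borel (\<Lambda> {0<..b})) u = exp (b * \<psi> u)" if "b \<ge> 0" for b u
  proof -
    have "distr M borel (\<Lambda> {0<..b}) = distr M borel (L1 b)"
    proof (rule distr_cong_AE)
      show "AE \<omega> in M. \<Lambda> {0<..b} \<omega> = L1 b \<omega>"
        using AE_\<Lambda>[OF that] AE_L AE_0 by eventually_elim (use that in auto)
    qed (use meas that in auto)
    then show ?thesis using char1 that by simp
  qed
  have neg: "char (distr M borel (\<Lambda> {a<..0})) u = exp (- a * \<psi> u)" if a: "a \<le> 0" for a u
  proof (cases "a = 0")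
    case True
    then show ?thesis using pos[of 0] by simp
  next
    case False
    with a have a: "a < 0" by simp
    \<comment> \<open>The value \<open>- L a\<close> is a left limit of \<open>L2\<close> at
      \<open>- a\<close>, so the approximating times must stay strictly below
      \<open>- a\<close>.\<close>
    define s where "s n = - a * (real n / real (Suc n))" for n
    have s: "s n \<ge> 0" "s n < - a" for n
      using a by (auto simp: s_def field_simps mult_nonpos_nonneg)
    have "s \<longlonglongrightarrow> - a * 1"
      unfolding s_def by (intro tendsto_mult tendsto_const LIMSEQ_n_over_Suc_n)
    then have lim: "filterlim s (at_left (- a)) sequentially" "s \<longlonglongrightarrow> - a"
      using s by (auto simp: filterlim_at intro!: always_eventually less_imp_neq)
    have [measurable]: "L2 (s n) \<in> borel_measurable M" for n using meas s by auto
    have "AE \<omega> in M. (\<lambda>n. L2 (s n) \<omega>) \<longlonglongrightarrow> - L a \<omega>"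
      using AE_L by eventually_elim (use a lim(1) filterlim_compose in blast)
    then have "(\<lambda>n. char (distr M borel (L2 (s n))) u) \<longlonglongrightarrow> char (distr M borel (\<lambda>\<omega>. - L a \<omega>)) u"
      by (intro char_tendsto) auto
    moreover have "(\<lambda>n. exp (s n * \<psi> u)) \<longlonglongrightarrow> exp (of_real (- a) * \<psi> u)"
      by (intro tendsto_intros lim)
    ultimately have "char (distr M borel (\<lambda>\<omega>. - L a \<omega>)) u = exp (of_real (- a) * \<psi> u)"
      using char2 s by (simp add: LIMSEQ_unique)
    moreover have "distr M borel (\<Lambda> {a<..0}) = distr M borel (\<lambda>\<omega>. - L a \<omega>)"
    proof (rule distr_cong_AE)
      show "AE \<omega> in M. \<Lambda> {a<..0} \<omega> = - L a \<omega>"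
        using AE_\<Lambda>[OF less_imp_le[OF a]] AE_L AE_0 by eventually_elim (use a in auto)
    qed auto
    ultimately show ?thesis by simp
  qed
  have split: "char (distr M borel (\<Lambda> {a<..c})) u =
      char (distr M borel (\<Lambda> {a<..b})) u * char (distr M borel (\<Lambda> {b<..c})) u"
    if "a \<le> b" "b \<le> c" for a b c u
  proof -
    have "{a<..c} = {a<..b} \<union> {b<..c}" using that by auto
    then show ?thesis
      by (simp only:, intro scattered_Un(2))
        (auto intro: bounded_subset[OF bounded_closed_interval[of a b]]
          bounded_subset[OF bounded_closed_interval[of b c]])
  qed
  have Ioc: "char (distr M borel (\<Lambda> {a<..b})) u = exp (of_real (b - a) * \<psi> u)" if "a \<le> b" for a b u
  proof (cases "0 \<le> a")
    case True
    then have "exp (b * \<psi> u) = exp (a * \<psi> u) * char (distr M borel (\<Lambda> {a<..b})) u"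
      using split[of 0 a b u] pos that by simp
    moreover have "exp (b * \<psi> u) = exp (a * \<psi> u) * exp (of_real (b - a) * \<psi> u)"
      by (simp add: exp_add[symmetric] algebra_simps)
    ultimately show ?thesis by simp
  next
    case a: False
    show ?thesis
    proof (cases "b \<le> 0")
      case True
      then have "exp (- a * \<psi> u) = char (distr M borel (\<Lambda> {a<..b})) u * exp (- b * \<psi> u)"
        using split[of a b 0 u] neg that by simp
      moreover have "exp (- a * \<psi> u) = exp (of_real (b - a) * \<psi> u) * exp (- b * \<psi> u)"
        by (simp add: exp_add[symmetric] algebra_simps)
      ultimately show ?thesis by simp
    next
      case False
      then show ?thesis
        using split[of a 0 b u] neg[of a u] pos[of b u] a
        by (simp add: exp_add[symmetric] algebra_simps)
    qed
  qed
  have \<nu>: "levy_measure \<nu>" using triplet by (simp add: characteristic_triplet_def)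
  show ?thesis
    using Ioc levy_exponent_continuous[OF \<nu>] levy_exponent_zero
    by unfold_locales (auto simp: \<psi>_def)
qed

section \<open>Integrals of compactly supported Lipschitz functions\<close>

lemma (in scattered_measure) has_levy_integral_add_cmult:
  assumes f: "has_levy_integral M \<Lambda> f Y" and f': "has_levy_integral M \<Lambda> f' Y'"
  shows "has_levy_integral M \<Lambda> (\<lambda>s. f s + c * f' s) (\<lambda>\<omega>. Y \<omega> + c * Y' \<omega>)"
proof -
  have [measurable]: "f \<in> borel_measurable borel" "f' \<in> borel_measurable borel"
    "Y \<in> borel_measurable M" "Y' \<in> borel_measurable M"
    using f f' by (auto simp: has_levy_integral_def)
  obtain g where g: "\<And>n. step_function (g n)" "AE s in lborel. (\<lambda>n. g n s) \<longlonglongrightarrow> f s"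
    "\<And>A. A \<in> sets borel \<Longrightarrow> \<exists>Z\<in>borel_measurable M. tendsto_in_prob M (\<lambda>n. step_integral \<Lambda> A (g n)) Z"
    "tendsto_in_prob M (\<lambda>n. step_integral \<Lambda> UNIV (g n)) Y"
    using f unfolding has_levy_integral_def by blast
  obtain g' where g': "\<And>n. step_function (g' n)" "AE s in lborel. (\<lambda>n. g' n s) \<longlonglongrightarrow> f' s"
    "\<And>A. A \<in> sets borel \<Longrightarrow> \<exists>Z\<in>borel_measurable M. tendsto_in_prob M (\<lambda>n. step_integral \<Lambda> A (g' n)) Z"
    "tendsto_in_prob M (\<lambda>n. step_integral \<Lambda> UNIV (g' n)) Y'"
    using f' unfolding has_levy_integral_def by blast
  let ?g = "\<lambda>n s. g n s + c * g' n s"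
  have step: "step_function (?g n)" for n by (intro step_function_add_cmult g g')
  have lim: "tendsto_in_prob M (\<lambda>n. step_integral \<Lambda> A (?g n)) (\<lambda>\<omega>. Z \<omega> + c * Z' \<omega>)"
    if "A \<in> sets borel" "Z \<in> borel_measurable M" "Z' \<in> borel_measurable M"
      and Z: "tendsto_in_prob M (\<lambda>n. step_integral \<Lambda> A (g n)) Z"
      and Z': "tendsto_in_prob M (\<lambda>n. step_integral \<Lambda> A (g' n)) Z'" for A Z Z'
  proof (rule tendsto_in_prob_cong_AE[OF _ _ _ _ tendsto_in_prob_add_cmult[OF _ _ _ _ Z Z']])
    show "AE \<omega> in M. step_integral \<Lambda> A (g n) \<omega> + c * step_integral \<Lambda> A (g' n) \<omega> =
        step_integral \<Lambda> A (?g n) \<omega>" for n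
      using step_integral_add_cmult[OF g(1)[of n] g'(1)[of n] that(1), of c] by eventually_elim simp
  qed (use that g(1) g'(1) step in auto)
  show ?thesis
    unfolding has_levy_integral_def
  proof (intro conjI exI[of _ ?g] allI ballI)
    show "AE s in lborel. (\<lambda>n. ?g n s) \<longlonglongrightarrow> f s + c * f' s"
      using g(2) g'(2) by eventually_elim (intro tendsto_intros)
    show "\<exists>Z\<in>borel_measurable M. tendsto_in_prob M (\<lambda>n. step_integral \<Lambda> A (?g n)) Z"
      if A: "A \<in> sets borel" for A
    proof -
      from g(3)[OF A] g'(3)[OF A] obtain Z Z' where Z: "Z \<in> borel_measurable M" "Z' \<in> borel_measurable M"
        "tendsto_in_prob M (\<lambda>n. step_integral \<Lambda> A (g n)) Z"
        "tendsto_in_prob M (\<lambda>n. step_integral \<Lambda> A (g' n)) Z'" by blast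
      from lim[OF A this] Z(1,2) show ?thesis by (intro bexI[of _ "\<lambda>\<omega>. Z \<omega> + c * Z' \<omega>"]) auto
    qed
    show "tendsto_in_prob M (\<lambda>n. step_integral \<Lambda> UNIV (?g n)) (\<lambda>\<omega>. Y \<omega> + c * Y' \<omega>)"
      by (rule lim) (use g g' in auto)
  qed (use step in auto)
qed

section \<open>Summation by parts and Riemann sums on uniform grids\<close>

lemma sum_by_parts:
  fixes h x :: "nat \<Rightarrow> real"
  shows "(\<Sum>i<n. h i * (x (Suc i) - x i)) =
    h n * x n - h 0 * x 0 - (\<Sum>i<n. x (Suc i) * (h (Suc i) - h i))"
  by (induction n) (auto simp: algebra_simps)

text \<open>The boundary terms vanish, and a difference of two decreasing sequences has total
  variation at most the sum of their total decreases.\<close>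

lemma sum_by_parts_bound:
  fixes h x \<phi> \<phi>' :: "nat \<Rightarrow> real"
  assumes "h 0 = 0" "h n = 0" and h: "\<And>i. i \<le> n \<Longrightarrow> h i = \<phi> i - \<phi>' i"
    and anti: "\<And>i. i < n \<Longrightarrow> \<phi> (Suc i) \<le> \<phi> i" "\<And>i. i < n \<Longrightarrow> \<phi>' (Suc i) \<le> \<phi>' i"
    and x: "\<And>i. i \<le> n \<Longrightarrow> \<bar>x i\<bar> \<le> C"
  shows "\<bar>\<Sum>i<n. h i * (x (Suc i) - x i)\<bar> \<le> C * (\<phi> 0 - \<phi> n + \<phi>' 0 - \<phi>' n)"
proof -
  have "\<bar>\<Sum>i<n. h i * (x (Suc i) - x i)\<bar> = \<bar>\<Sum>i<n. x (Suc i) * (h (Suc i) - h i)\<bar>"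
    using assms(1,2) by (simp add: sum_by_parts)
  also have "\<dots> \<le> (\<Sum>i<n. C * ((\<phi> i + \<phi>' i) - (\<phi> (Suc i) + \<phi>' (Suc i))))"
  proof (rule order_trans[OF sum_abs sum_mono])
    fix i assume "i \<in> {..<n}"
    then have i: "i < n" by simp
    have "\<bar>x (Suc i)\<bar> \<le> C" using x i by auto
    moreover have "\<bar>h (Suc i) - h i\<bar> \<le> (\<phi> i + \<phi>' i) - (\<phi> (Suc i) + \<phi>' (Suc i))"
      using h[of i] h[of "Suc i"] anti[OF i] i by auto
    ultimately show "\<bar>x (Suc i) * (h (Suc i) - h i)\<bar> \<le> C * ((\<phi> i + \<phi>' i) - (\<phi> (Suc i) + \<phi>' (Suc i)))"
      unfolding abs_mult by (intro mult_mono) auto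
  qed
  also have "\<dots> = C * (\<phi> 0 - \<phi> n + \<phi>' 0 - \<phi>' n)"
    unfolding sum_distrib_left[symmetric]
    by (subst sum_lessThan_telescope'[of "\<lambda>i. \<phi> i + \<phi>' i"]) simp
  finally show ?thesis .
qed

text \<open>The cells are half-open on the left; cell \<open>0\<close> is the complement of \<open>(0, N w]\<close>.\<close>

definition cell :: "real \<Rightarrow> nat \<Rightarrow> real \<Rightarrow> nat" where
  "cell w N s = (if 0 < s \<and> s \<le> real N * w then nat \<lceil>s / w\<rceil> else 0)"

lemma cell_eq_Suc_iff:
  assumes "w > 0" "i < N"
  shows "cell w N s = Suc i \<longleftrightarrow> real i * w < s \<and> s \<le> real (Suc i) * w"
proof -
  have *: "nat \<lceil>s / w\<rceil> = Suc i \<longleftrightarrow> real i * w < s \<and> s \<le> real (Suc i) * w"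
  proof -
    have "nat \<lceil>s / w\<rceil> = Suc i \<longleftrightarrow> \<lceil>s / w\<rceil> = int (Suc i)" by auto
    also have "\<dots> \<longleftrightarrow> real i * w < s \<and> s \<le> real (Suc i) * w"
      using assms(1) by (auto simp: ceiling_eq_iff field_simps)
    finally show ?thesis .
  qed
  have "0 < s \<and> s \<le> real N * w" if "real i * w < s" "s \<le> real (Suc i) * w"
  proof
    have "0 \<le> real i * w" using assms by simp
    with that show "0 < s" by linarith
    have "real (Suc i) * w \<le> real N * w" using assms by (intro mult_right_mono) auto
    with that show "s \<le> real N * w" by linarith
  qed
  with * show ?thesis by (auto simp: cell_def)
qed

lemma cell_le:
  assumes "w > 0"
  shows "cell w N s \<le> N"
proof -
  have "nat \<lceil>s / w\<rceil> \<le> N" if "s \<le> real N * w"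
    using that assms by (simp add: nat_le_iff ceiling_le_iff field_simps)
  then show ?thesis by (auto simp: cell_def)
qed

lemma cell_vimage_Suc: "w > 0 \<Longrightarrow> i < N \<Longrightarrow> cell w N -` {Suc i} = {real i * w<..real (Suc i) * w}"
  using cell_eq_Suc_iff by (auto simp: vimage_def)

lemma cell_0_iff: "w > 0 \<Longrightarrow> cell w N s = 0 \<longleftrightarrow> \<not> (0 < s \<and> s \<le> real N * w)"
  using divide_pos_pos[of s w] by (auto simp: cell_def not_le)

lemma measurable_cell: "cell w N -` {i} \<in> sets borel"
proof -
  have "cell w N \<in> measurable borel (count_space UNIV)"
    unfolding cell_def by measurable
  from measurable_sets[OF this, of "{i}"] show ?thesis by simp
qed

lemma range_cell:
  assumes "w > 0"
  shows "range (cell w N) = {..N}"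
proof
  show "{..N} \<subseteq> range (cell w N)"
  proof
    fix i assume "i \<in> {..N}"
    then show "i \<in> range (cell w N)"
      using cell_0_iff[OF assms, of N 0] cell_eq_Suc_iff[OF assms, of "i - 1" N "real i * w"] assms
      by (cases i) (auto intro: range_eqI[symmetric] simp: image_iff, metis+)
  qed
qed (use cell_le[OF assms] in auto)

text \<open>Cell \<open>Suc i\<close> starts at \<open>i * w\<close>, and the step takes the value
  there. Left endpoints give exactly the sums treated by \<open>sum_by_parts\<close>.\<close>

definition grid_step :: "(real \<Rightarrow> real) \<Rightarrow> real \<Rightarrow> nat \<Rightarrow> real \<Rightarrow> real" where
  "grid_step h w N s = (case cell w N s of 0 \<Rightarrow> 0 | Suc i \<Rightarrow> h (real i * w))"

lemma grid_step_support: "w > 0 \<Longrightarrow> {s. grid_step h w N s \<noteq> 0} \<subseteq> {0..real N * w}"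
  by (auto simp: grid_step_def cell_def split: if_splits)

lemma step_function_grid_step:
  assumes "w > 0"
  shows "step_function (grid_step h w N)"
proof (rule step_functionI)
  have "range (grid_step h w N) \<subseteq> (\<lambda>n. case n of 0 \<Rightarrow> 0 | Suc i \<Rightarrow> h (real i * w)) ` {..N}"
    using cell_le[OF assms] by (auto simp: grid_step_def)
  then show "finite (range (grid_step h w N))" by (rule finite_subset) simp
  have "cell w N \<in> measurable borel (count_space UNIV)"
    unfolding cell_def by measurable
  then show "grid_step h w N \<in> borel_measurable borel"
    unfolding grid_step_def by (rule measurable_compose) simp
  show "bounded {s. grid_step h w N s \<noteq> 0}"
    by (rule bounded_subset[OF _ grid_step_support[OF assms]]) simp
qed

lemma grid_step_error:
  assumes "w > 0" and lip: "\<And>x y. \<bar>h x - h y\<bar> \<le> K * \<bar>x - y\<bar>" and K: "K \<ge> 0"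
    and supp: "\<And>s. s \<le> 0 \<or> s \<ge> real N * w \<Longrightarrow> h s = 0"
  shows "\<bar>grid_step h w N s - h s\<bar> \<le> K * w"
proof (cases "cell w N s")
  case 0
  then have "h s = 0" using supp[of s] cell_0_iff[OF assms(1)] by force
  with 0 K assms(1) show ?thesis by (simp add: grid_step_def)
next
  case (Suc i)
  then have "i < N" using cell_le[OF assms(1), of N s] by simp
  then have "real i * w < s" "s \<le> real (Suc i) * w"
    using Suc cell_eq_Suc_iff[OF assms(1)] by blast+
  then have "\<bar>real i * w - s\<bar> \<le> w" by (simp add: algebra_simps)
  then have "K * \<bar>real i * w - s\<bar> \<le> K * w" using K by (rule mult_left_mono)
  with lip[of "real i * w" s] Suc show ?thesis by (simp add: grid_step_def)
qed

lemma (in scattered_measure) step_integral_grid_step: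
  assumes w: "w > 0"
  shows "AE \<omega> in M. step_integral \<Lambda> UNIV (grid_step h w N) \<omega> =
    (\<Sum>i<N. h (real i * w) * \<Lambda> {real i * w<..real (Suc i) * w} \<omega>)"
proof -
  let ?F = "\<lambda>n. case n of 0 \<Rightarrow> 0 | Suc i \<Rightarrow> h (real i * w)"
  have "AE \<omega> in M. step_integral \<Lambda> UNIV (\<lambda>s. ?F (cell w N s)) \<omega> =
      (\<Sum>z\<in>range (cell w N). ?F z * \<Lambda> (UNIV \<inter> cell w N -` {z}) \<omega>)"
  proof (rule step_integral_comp)
    show "bounded {s. ?F (cell w N s) \<noteq> 0}"
      using step_functionD(4)[OF step_function_grid_step[OF w]] by (simp add: grid_step_def)
  qed (use range_cell[OF w] measurable_cell in auto)
  then show ?thesis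
    by eventually_elim
      (simp add: range_cell[OF w] sum.atMost_shift cell_vimage_Suc[OF w] flip: grid_step_def)
qed

text \<open>\<open>\<phi>\<close> and \<open>\<phi>'\<close> play the role of a Jordan decomposition
  of \<open>h\<close>. The exceptional set is the same for all \<open>C\<close>, so \<open>C\<close>
  may later be a bound depending on the path.\<close>

lemma (in levy_basis) levy_integral_bound:
  fixes h :: "real \<Rightarrow> real"
  assumes L: "levy_random_measure M L \<Lambda>" and h: "has_levy_integral M \<Lambda> h Y" and T: "T > 0"
    and lip: "\<And>x y. \<bar>h x - h y\<bar> \<le> K * \<bar>x - y\<bar>" and K: "K \<ge> 0"
    and supp: "\<And>s. s \<le> 0 \<or> s \<ge> T \<Longrightarrow> h s = 0"
    and eq: "\<And>s. 0 \<le> s \<Longrightarrow> s \<le> T \<Longrightarrow> h s = \<phi> s - \<phi>' s"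
    and anti: "antimono_on {0..T} \<phi>" "antimono_on {0..T} \<phi>'"
  shows "AE \<omega> in M. \<forall>C. (\<forall>s\<in>{0..T}. \<bar>L s \<omega>\<bar> \<le> C) \<longrightarrow>
    \<bar>Y \<omega>\<bar> \<le> C * (\<phi> 0 - \<phi> T + \<phi>' 0 - \<phi>' T)"
proof -
  have [measurable]: "Y \<in> borel_measurable M" using h by (simp add: has_levy_integral_def)
  obtain g where g: "\<And>n. step_function (g n)" "AE s in lborel. (\<lambda>n. g n s) \<longlonglongrightarrow> h s"
    "\<And>A. A \<in> sets borel \<Longrightarrow> \<exists>Z\<in>borel_measurable M. tendsto_in_prob M (\<lambda>n. step_integral \<Lambda> A (g n)) Z"
    "tendsto_in_prob M (\<lambda>n. step_integral \<Lambda> UNIV (g n)) Y"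
    using h unfolding has_levy_integral_def by blast
  \<comment> \<open>Squaring makes the mesh \<open>w n\<close> so fine that even
    \<open>n * w n\<close> tends to 0, as required by the factor \<open>n\<close> in
    \<open>step_integral_tendsto_zero\<close>.\<close>
  define N where "N n = (Suc n)\<^sup>2" for n :: nat
  define w where "w n = T / real (N n)" for n
  define r where "r n = grid_step h (w n) (N n)" for n
  have N: "N n > 0" for n by (simp add: N_def)
  have w: "w n > 0" for n using T N by (simp add: w_def)
  have Nw: "real (N n) * w n = T" for n using N[of n] by (simp add: w_def)
  have r: "step_function (r n)" for n unfolding r_def using w by (rule step_function_grid_step)
  have r_supp: "{s. r n s \<noteq> 0} \<subseteq> {0..T}" for n
    using grid_step_support[OF w, of h n "N n"] by (simp add: r_def Nw)
  have r_err: "\<bar>r n s - h s\<bar> \<le> K * w n" for n s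
    unfolding r_def by (rule grid_step_error[OF w lip K]) (use supp Nw in auto)
  have w_lim: "(\<lambda>n. real n * w n) \<longlonglongrightarrow> 0" "w \<longlonglongrightarrow> 0"
  proof -
    have inv: "(\<lambda>n. T * inverse (real (Suc n))) \<longlonglongrightarrow> 0"
      by (rule tendsto_mult_right_zero[OF LIMSEQ_inverse_real_of_nat])
    have "real n * w n = T * inverse (real (Suc n)) * (real n / real (Suc n))" for n
      by (simp add: w_def N_def field_simps power2_eq_square)
    then show "(\<lambda>n. real n * w n) \<longlonglongrightarrow> 0"
      using tendsto_mult[OF inv LIMSEQ_n_over_Suc_n] by simp
    have "w = (\<lambda>n. T * inverse (real (Suc n)) * inverse (real (Suc n)))"
      by (simp add: fun_eq_iff w_def N_def field_simps power2_eq_square)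
    then show "w \<longlonglongrightarrow> 0"
      using tendsto_mult[OF inv LIMSEQ_inverse_real_of_nat] by simp
  qed
  have w_anti: "w (a n) \<le> w n" if "strict_mono a" for a n
    unfolding w_def N_def using seq_suble[OF that, of n] T
    by (intro divide_left_mono) (auto intro!: power_mono)

  \<comment> \<open>Two Riemann step functions differ by at most the sum of their errors to
    \<open>h\<close>. Since \<open>a k\<close> and \<open>b k\<close> are at least \<open>k\<close>,
    this is at most \<open>2 * K * w k\<close>.\<close>
  have r_cauchy: "tendsto_in_prob M (\<lambda>k \<omega>. step_integral \<Lambda> A (r (a k)) \<omega> - step_integral \<Lambda> A (r (b k)) \<omega>) (\<lambda>_. 0)"
    if A: "A \<in> sets borel" and ab: "strict_mono a" "strict_mono b" for A and a b :: "nat \<Rightarrow> nat"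
  proof -
    let ?d = "\<lambda>k s. r (a k) s + (- 1) * r (b k) s"
    have d: "step_function (?d k)" for k by (intro step_function_add_cmult r)
    have d_supp: "{s. ?d k s \<noteq> 0} \<subseteq> {0..T}" for k
    proof -
      have "{s. ?d k s \<noteq> 0} \<subseteq> {s. r (a k) s \<noteq> 0} \<union> {s. r (b k) s \<noteq> 0}" by auto
      then show ?thesis using r_supp by blast
    qed
    have "tendsto_in_prob M (\<lambda>k. step_integral \<Lambda> (A \<inter> {0..T}) (?d k)) (\<lambda>_. 0)"
    proof (rule step_integral_tendsto_zero[OF d])
      show "bounded (A \<inter> {0..T})" by (rule bounded_subset[OF bounded_closed_interval]) auto
      show "\<bar>?d k s\<bar> \<le> 2 * K * w k" for k s
      proof -
        have "K * w (a k) \<le> K * w k" "K * w (b k) \<le> K * w k"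
          using ab w_anti K by (auto intro!: mult_left_mono)
        then show ?thesis using r_err[of "a k" s] r_err[of "b k" s] by linarith
      qed
      show "0 \<le> 2 * K * w k" for k using K less_imp_le[OF w] by simp
      have "(\<lambda>k. 2 * K * (real k * w k)) \<longlonglongrightarrow> 0"
        using tendsto_mult_right_zero[OF w_lim(1)] by simp
      then have x: "(\<lambda>k. real k * (2 * K * w k)) \<longlonglongrightarrow> 0" by (simp add: ac_simps)
      have "(\<lambda>k. bound_exponent (real k * (2 * K * w k))) \<longlonglongrightarrow> 0"
      proof (rule LIMSEQ_I)
        fix e :: real assume "e > 0"
        then obtain \<delta> where \<delta>: "\<delta> > 0" "bound_exponent \<delta> \<le> e / 2"
          using bound_exponent_small[of "e / 2"] by auto
        have "\<forall>\<^sub>F k in sequentially. real k * (2 * K * w k) < \<delta>"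
          using x \<delta>(1) by (rule order_tendstoD(2))
        then have "\<forall>\<^sub>F k in sequentially. norm (bound_exponent (real k * (2 * K * w k)) - 0) < e"
        proof eventually_elim
          case (elim k)
          have nonneg: "0 \<le> real k * (2 * K * w k)" using K less_imp_le[OF w] by simp
          with elim have "bound_exponent (real k * (2 * K * w k)) \<le> bound_exponent \<delta>"
            by (intro bound_exponent_mono) auto
          with \<delta>(2) \<open>e > 0\<close> bound_exponent_nonneg[OF nonneg] show ?case by simp
        qed
        then show "\<exists>no. \<forall>k\<ge>no. norm (bound_exponent (real k * (2 * K * w k)) - 0) < e"
          by (simp add: eventually_sequentially)
      qed
      then show "(\<lambda>k. measure lborel (A \<inter> {0..T}) * bound_exponent (real k * (2 * K * w k))) \<longlonglongrightarrow> 0"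
        by (rule tendsto_mult_right_zero)
    qed (use A in auto)
    moreover have "step_integral \<Lambda> (A \<inter> {0..T}) (?d k) = step_integral \<Lambda> A (?d k)" for k
    proof
      have eq: "A \<inter> {0..T} \<inter> {s. ?d k s \<noteq> 0} = A \<inter> {s. ?d k s \<noteq> 0}" using d_supp[of k] by blast
      show "step_integral \<Lambda> (A \<inter> {0..T}) (?d k) \<omega> = step_integral \<Lambda> A (?d k) \<omega>" for \<omega>
        by (simp only: step_integral_support[of \<Lambda> "A \<inter> {0..T}" "?d k" \<omega>]
            step_integral_support[of \<Lambda> A "?d k" \<omega>] eq)
    qed
    ultimately have lim: "tendsto_in_prob M (\<lambda>k. step_integral \<Lambda> A (?d k)) (\<lambda>_. 0)" by simp
    show ?thesis
    proof (rule tendsto_in_prob_cong_AE[OF _ _ _ _ lim])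
      show "AE \<omega> in M. step_integral \<Lambda> A (?d k) \<omega> =
          step_integral \<Lambda> A (r (a k)) \<omega> - step_integral \<Lambda> A (r (b k)) \<omega>" for k
        using step_integral_add_cmult[OF r r A, of "a k" "- 1" "b k"] by simp
    qed (use r d A in auto)
  qed

  \<comment> \<open>The difference between the unknown approximation and the Riemann steps tends to
    0 almost everywhere, so the gliding hump applies to it; its Cauchy property combines the assumed
    limits for \<open>g\<close> with \<open>r_cauchy\<close>.\<close>
  let ?q = "\<lambda>n s. g n s + (- 1) * r n s"
  have q: "step_function (?q n)" for n by (intro step_function_add_cmult g r)
  have q_AE: "AE \<omega> in M. step_integral \<Lambda> A (?q n) \<omega> =
      step_integral \<Lambda> A (g n) \<omega> + (- 1) * step_integral \<Lambda> A (r n) \<omega>" if "A \<in> sets borel" for A n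
    by (rule step_integral_add_cmult[OF g(1) r that])
  have q_lim: "AE s in lborel. (\<lambda>n. ?q n s) \<longlonglongrightarrow> 0"
    using g(2)
  proof eventually_elim
    case (elim s)
    have "(\<lambda>n. r n s - h s) \<longlonglongrightarrow> 0"
      using r_err by (intro Lim_null_comparison[OF always_eventually tendsto_mult_right_zero[OF w_lim(2)]]) auto
    then have "(\<lambda>n. r n s) \<longlonglongrightarrow> h s" by (rule LIM_zero_cancel)
    from tendsto_add[OF elim tendsto_mult_left[OF this, of "- 1"]] show ?case by simp
  qed
  have q_cauchy: "tendsto_in_prob M (\<lambda>k \<omega>. step_integral \<Lambda> A (?q (a k)) \<omega> - step_integral \<Lambda> A (?q (b k)) \<omega>) (\<lambda>_. 0)"
    if A: "A \<in> sets borel" and ab: "strict_mono a" "strict_mono b" for A and a b :: "nat \<Rightarrow> nat"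
  proof -
    obtain Z where [measurable]: "Z \<in> borel_measurable M"
      and Z: "tendsto_in_prob M (\<lambda>n. step_integral \<Lambda> A (g n)) Z" using g(3)[OF A] by blast
    have "tendsto_in_prob M (\<lambda>k \<omega>. step_integral \<Lambda> A (g (a k)) \<omega> + (- 1) * step_integral \<Lambda> A (g (b k)) \<omega>)
        (\<lambda>\<omega>. Z \<omega> + (- 1) * Z \<omega>)"
      using A g(1) tendsto_in_prob_subseq[OF Z ab(1)] tendsto_in_prob_subseq[OF Z ab(2)]
      by (intro tendsto_in_prob_add_cmult) auto
    then have "tendsto_in_prob M (\<lambda>k \<omega>. (step_integral \<Lambda> A (g (a k)) \<omega> - step_integral \<Lambda> A (g (b k)) \<omega>)
        + (- 1) * (step_integral \<Lambda> A (r (a k)) \<omega> - step_integral \<Lambda> A (r (b k)) \<omega>)) (\<lambda>\<omega>. 0 + (- 1) * 0)"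
      using A g(1) r r_cauchy[OF A ab] by (intro tendsto_in_prob_add_cmult) auto
    then have lim: "tendsto_in_prob M (\<lambda>k \<omega>. (step_integral \<Lambda> A (g (a k)) \<omega> - step_integral \<Lambda> A (g (b k)) \<omega>)
        + (- 1) * (step_integral \<Lambda> A (r (a k)) \<omega> - step_integral \<Lambda> A (r (b k)) \<omega>)) (\<lambda>_. 0)" by simp
    show ?thesis
    proof (rule tendsto_in_prob_cong_AE[OF _ _ _ _ lim])
      show "AE \<omega> in M. (step_integral \<Lambda> A (g (a k)) \<omega> - step_integral \<Lambda> A (g (b k)) \<omega>)
          + (- 1) * (step_integral \<Lambda> A (r (a k)) \<omega> - step_integral \<Lambda> A (r (b k)) \<omega>) =
          step_integral \<Lambda> A (?q (a k)) \<omega> - step_integral \<Lambda> A (?q (b k)) \<omega>" for k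
        using q_AE[OF A, of "a k"] q_AE[OF A, of "b k"]
        by eventually_elim (simp only: algebra_simps)
    qed (use g(1) r q A in auto)
  qed
  obtain \<rho> where \<rho>: "strict_mono \<rho>"
    "tendsto_in_prob M (\<lambda>k. step_integral \<Lambda> UNIV (?q (\<rho> k))) (\<lambda>_. 0)"
    by (rule step_integral_null_subsequence[of ?q, OF q q_lim q_cauchy])
  have "tendsto_in_prob M (\<lambda>k \<omega>. step_integral \<Lambda> UNIV (g (\<rho> k)) \<omega> + (- 1) * step_integral \<Lambda> UNIV (?q (\<rho> k)) \<omega>)
      (\<lambda>\<omega>. Y \<omega> + (- 1) * 0)"
    using tendsto_in_prob_subseq[OF g(4) \<rho>(1)] \<rho>(2) g(1) q
    by (intro tendsto_in_prob_add_cmult) auto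
  then have lim: "tendsto_in_prob M (\<lambda>k \<omega>. step_integral \<Lambda> UNIV (g (\<rho> k)) \<omega> + (- 1) * step_integral \<Lambda> UNIV (?q (\<rho> k)) \<omega>) Y"
    by simp
  have r_lim: "tendsto_in_prob M (\<lambda>k. step_integral \<Lambda> UNIV (r (\<rho> k))) Y"
  proof (rule tendsto_in_prob_cong_AE[OF _ _ _ _ lim])
    show "AE \<omega> in M. step_integral \<Lambda> UNIV (g (\<rho> k)) \<omega> + (- 1) * step_integral \<Lambda> UNIV (?q (\<rho> k)) \<omega> =
        step_integral \<Lambda> UNIV (r (\<rho> k)) \<omega>" for k
    proof -
      have "AE \<omega> in M. step_integral \<Lambda> UNIV (?q (\<rho> k)) \<omega> =
          step_integral \<Lambda> UNIV (g (\<rho> k)) \<omega> + (- 1) * step_integral \<Lambda> UNIV (r (\<rho> k)) \<omega>"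
        by (rule q_AE) simp
      then show ?thesis by eventually_elim simp
    qed
  qed (use g(1) r q in auto)
  obtain \<tau> where "strict_mono \<tau>" and
    \<tau>: "AE \<omega> in M. (\<lambda>k. step_integral \<Lambda> UNIV (r (\<rho> (\<tau> k))) \<omega>) \<longlonglongrightarrow> Y \<omega>"
    using tendsto_in_prob_AE_subseq[OF _ _ r_lim] r by auto

  have "AE \<omega> in M. \<forall>n. step_integral \<Lambda> UNIV (r n) \<omega> =
      (\<Sum>i<N n. h (real i * w n) * (L (real (Suc i) * w n) \<omega> - L (real i * w n) \<omega>))"
  proof (subst AE_all_countable, rule allI)
    fix n
    have "AE \<omega> in M. \<forall>i\<in>{..<N n}. \<Lambda> {real i * w n<..real (Suc i) * w n} \<omega> =
        L (real (Suc i) * w n) \<omega> - L (real i * w n) \<omega>"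
    proof (subst AE_finite_all[OF finite_lessThan], rule ballI)
      have le: "real i * w n \<le> real (Suc i) * w n" for i
        using less_imp_le[OF w] by (intro mult_right_mono) auto
      show "AE \<omega> in M. \<Lambda> {real i * w n<..real (Suc i) * w n} \<omega> =
        L (real (Suc i) * w n) \<omega> - L (real i * w n) \<omega>" for i
        using L le unfolding levy_random_measure_def by blast
    qed
    then show "AE \<omega> in M. step_integral \<Lambda> UNIV (r n) \<omega> =
        (\<Sum>i<N n. h (real i * w n) * (L (real (Suc i) * w n) \<omega> - L (real i * w n) \<omega>))"
      using step_integral_grid_step[OF w[of n], of h "N n"]
      by eventually_elim (simp add: r_def)
  qed
  with \<tau> show ?thesis
  proof eventually_elim
    case (elim \<omega>)
    show ?case
    proof safe
      fix C assume C: "\<forall>s\<in>{0..T}. \<bar>L s \<omega>\<bar> \<le> C"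
      have "\<bar>step_integral \<Lambda> UNIV (r n) \<omega>\<bar> \<le> C * (\<phi> 0 - \<phi> T + \<phi>' 0 - \<phi>' T)" for n
      proof -
        have in_T: "real i * w n \<in> {0..T}" if "i \<le> N n" for i
        proof -
          have "real i * w n \<le> real (N n) * w n"
            using that less_imp_le[OF w] by (intro mult_right_mono) auto
          then show ?thesis using Nw less_imp_le[OF w] by simp
        qed
        have mono: "real i * w n \<le> real (Suc i) * w n" for i
          using less_imp_le[OF w] by (intro mult_right_mono) auto
        have "\<bar>\<Sum>i<N n. h (real i * w n) * (L (real (Suc i) * w n) \<omega> - L (real i * w n) \<omega>)\<bar> \<le>
            C * (\<phi> (real 0 * w n) - \<phi> (real (N n) * w n) + \<phi>' (real 0 * w n) - \<phi>' (real (N n) * w n))"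
        proof (rule sum_by_parts_bound)
          show "h (real i * w n) = \<phi> (real i * w n) - \<phi>' (real i * w n)" if "i \<le> N n" for i
            using eq in_T[OF that] by simp
          show "\<phi> (real (Suc i) * w n) \<le> \<phi> (real i * w n)" "\<phi>' (real (Suc i) * w n) \<le> \<phi>' (real i * w n)"
            if "i < N n" for i
            using in_T[of i] in_T[of "Suc i"] that mono[of i] anti
            by (auto simp: monotone_on_def simp del: of_nat_Suc)
        qed (use supp Nw in_T C in auto)
        then show ?thesis using elim(2) by (simp add: Nw)
      qed
      then show "\<bar>Y \<omega>\<bar> \<le> C * (\<phi> 0 - \<phi> T + \<phi>' 0 - \<phi>' T)"
        by (intro tendsto_upperbound[OF tendsto_rabs[OF elim(1)]] always_eventually) auto
    qed
  qed
qed

section \<open>Path regularity\<close>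

text \<open>Convexity of \<open>sinh\<close> on the nonnegative half-line: shifting an interval to
  the right and lengthening it cannot decrease the increment.\<close>

lemma sinh_increment_mono:
  fixes a b a' b' :: real
  assumes "0 \<le> b'" "b' \<le> b" "b' \<le> a'" "a' - b' \<le> a - b"
  shows "sinh a' - sinh b' \<le> sinh a - sinh b"
proof -
  define d where "d = a' - b'"
  have d: "d \<ge> 0" using assms by (simp add: d_def)
  have split: "sinh (x + d) - sinh x = sinh x * (cosh d - 1) + cosh x * sinh d" for x :: real
    by (simp add: sinh_add algebra_simps)
  have "sinh a' - sinh b' = sinh b' * (cosh d - 1) + cosh b' * sinh d"
    using split[of b'] by (simp add: d_def)
  also have "\<dots> \<le> sinh b * (cosh d - 1) + cosh b * sinh d"
    using assms d cosh_real_ge_1[of d]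
    by (intro add_mono mult_right_mono) (auto simp: cosh_real_nonneg_le_iff)
  also have "\<dots> = sinh (b + d) - sinh b" using split[of b] by simp
  also have "\<dots> \<le> sinh a - sinh b" using assms by (simp add: d_def)
  finally show ?thesis .
qed

lemma sinh_diff_le:
  fixes x y R :: real
  assumes "0 \<le> x" "x \<le> y" "y \<le> R"
  shows "sinh y - sinh x \<le> cosh R * (y - x)"
proof (cases "x = y")
  case False
  with assms have "x < y" by simp
  then obtain z where z: "x < z" "z < y" "sinh y - sinh x = (y - x) * cosh z"
    using MVT2[of x y sinh cosh] by (force intro!: derivative_eq_intros)
  have "cosh z \<le> cosh R" using z assms by (simp add: cosh_real_nonneg_le_iff)
  with z assms show ?thesis by (simp add: mult.commute mult_left_mono)
qed simp

text \<open>Isolates the kink at 0: once the smooth exponentials cancel in a linear combination,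
  only hyperbolic sines of positive parts remain.\<close>

lemma exp_minus_abs_eq: "exp (- l * \<bar>x\<bar>) = exp (l * x) - 2 * sinh (l * max x 0)" for l x :: real
  by (cases "x \<ge> 0") (auto simp: sinh_def field_simps max_def)

lemma exp_minus_abs_lipschitz:
  fixes l x y :: real
  assumes "l \<ge> 0"
  shows "\<bar>exp (- l * \<bar>x\<bar>) - exp (- l * \<bar>y\<bar>)\<bar> \<le> l * \<bar>x - y\<bar>"
proof -
  have *: "exp (- l * a) - exp (- l * b) \<le> l * (b - a)" if "0 \<le> a" "a \<le> b" for a b
  proof -
    have "exp (- l * a) - exp (- l * b) = exp (- l * a) * (1 - exp (- (l * (b - a))))"
      by (simp add: algebra_simps flip: exp_add)
    also have "\<dots> \<le> 1 * (1 - exp (- (l * (b - a))))"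
      using that assms by (intro mult_right_mono) auto
    also have "\<dots> \<le> l * (b - a)" using exp_ge_add_one_self[of "- (l * (b - a))"] by simp
    finally show ?thesis .
  qed
  have **: "\<bar>exp (- l * a) - exp (- l * b)\<bar> \<le> l * (b - a)" if "0 \<le> a" "a \<le> b" for a b
  proof -
    have "exp (- l * b) \<le> exp (- l * a)" using that assms by (simp add: mult_left_mono)
    then show ?thesis using *[OF that] by simp
  qed
  have "\<bar>exp (- l * \<bar>x\<bar>) - exp (- l * \<bar>y\<bar>)\<bar> \<le> l * \<bar>\<bar>x\<bar> - \<bar>y\<bar>\<bar>"
    using **[of "\<bar>x\<bar>" "\<bar>y\<bar>"] **[of "\<bar>y\<bar>" "\<bar>x\<bar>"] by (cases "\<bar>x\<bar> \<le> \<bar>y\<bar>") (auto simp: abs_minus_commute)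
  also have "\<dots> \<le> l * \<bar>x - y\<bar>" using assms by (intro mult_left_mono) auto
  finally show ?thesis .
qed

section \<open>Boundedness of cadlag paths and Lipschitz bounds\<close>

lemma cadlag_bounded:
  assumes f: "cadlag f" and T: "0 \<le> T"
  shows "\<exists>C. \<forall>s\<in>{0..T}. \<bar>f s\<bar> \<le> C"
proof -
  \<comment> \<open>The guard \<open>0 \<le> s\<close> is for the intervals around the point 0,
    which reach below 0, where \<open>cadlag\<close> gives no bound.\<close>
  have "\<exists>C. \<forall>s\<in>{0..T}. 0 \<le> s \<longrightarrow> \<bar>f s\<bar> \<le> C"
  proof (rule Bolzano[OF T, where P="\<lambda>a b. \<exists>C. \<forall>s\<in>{a..b}. 0 \<le> s \<longrightarrow> \<bar>f s\<bar> \<le> C"])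
    fix a b c
    assume "\<exists>C. \<forall>s\<in>{a..b}. 0 \<le> s \<longrightarrow> \<bar>f s\<bar> \<le> C" "\<exists>C. \<forall>s\<in>{b..c}. 0 \<le> s \<longrightarrow> \<bar>f s\<bar> \<le> C"
    then obtain C C' where C: "\<forall>s\<in>{a..b}. 0 \<le> s \<longrightarrow> \<bar>f s\<bar> \<le> C" "\<forall>s\<in>{b..c}. 0 \<le> s \<longrightarrow> \<bar>f s\<bar> \<le> C'"
      by blast
    have "\<bar>f s\<bar> \<le> max C C'" if "s \<in> {a..c}" "0 \<le> s" for s
      using that C by (cases "s \<le> b") (auto simp: le_max_iff_disj)
    then show "\<exists>C. \<forall>s\<in>{a..c}. 0 \<le> s \<longrightarrow> \<bar>f s\<bar> \<le> C" by blast
  next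
    fix x :: real assume x: "0 \<le> x" "x \<le> T"
    have "(f \<longlongrightarrow> f x) (at_right x)"
      using f x by (simp add: cadlag_def continuous_within)
    from order_tendstoD(2)[OF tendsto_rabs[OF this], of "\<bar>f x\<bar> + 1"]
    obtain r where r: "r > x" "\<And>s. x < s \<Longrightarrow> s < r \<Longrightarrow> \<bar>f s\<bar> < \<bar>f x\<bar> + 1"
      by (auto simp: eventually_at_right_field)
    have "\<exists>q<x. \<exists>C. \<forall>s. q < s \<longrightarrow> s < x \<longrightarrow> 0 \<le> s \<longrightarrow> \<bar>f s\<bar> \<le> C"
    proof (cases "x = 0")
      case True
      then show ?thesis by (intro exI[of _ "-1"]) auto
    next
      case False
      with x have "0 < x" by simp
      then obtain y where "(f \<longlongrightarrow> y) (at_left x)" using f unfolding cadlag_def by blast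
      from order_tendstoD(2)[OF tendsto_rabs[OF this], of "\<bar>y\<bar> + 1"]
      obtain q where "q < x" "\<And>s. q < s \<Longrightarrow> s < x \<Longrightarrow> \<bar>f s\<bar> < \<bar>y\<bar> + 1"
        by (auto simp: eventually_at_left_field)
      then show ?thesis by (meson less_imp_le)
    qed
    then obtain q C where q: "q < x" "\<And>s. q < s \<Longrightarrow> s < x \<Longrightarrow> 0 \<le> s \<Longrightarrow> \<bar>f s\<bar> \<le> C" by blast
    define D where "D = max C (\<bar>f x\<bar> + 1)"
    have "\<bar>f s\<bar> \<le> D" if "q < s" "s < r" "0 \<le> s" for s
      using that q(2)[of s] r(2)[of s] by (cases s x rule: linorder_cases) (auto simp: D_def le_max_iff_disj)
    then show "\<exists>d>0. \<forall>a b. a \<le> x \<and> x \<le> b \<and> b - a < d \<longrightarrow> (\<exists>C. \<forall>s\<in>{a..b}. 0 \<le> s \<longrightarrow> \<bar>f s\<bar> \<le> C)"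
      using q(1) r(1) by (intro exI[of _ "min (x - q) (r - x)"]) (auto intro!: exI[of _ D])
  qed
  then show ?thesis by auto
qed

text \<open>Both times are approximated by rationals from the right, which is why
  \<open>t < T\<close> must leave room above \<open>t\<close>.\<close>

lemma lipschitz_if_lipschitz_on_Rats:
  fixes f :: "real \<Rightarrow> real"
  assumes cont: "\<And>t. 0 \<le> t \<Longrightarrow> t < T \<Longrightarrow> continuous (at_right t) f"
    and rat: "\<And>r t. r \<in> \<rat> \<Longrightarrow> t \<in> \<rat> \<Longrightarrow> 0 \<le> r \<Longrightarrow> r \<le> t \<Longrightarrow> t \<le> T \<Longrightarrow> \<bar>f t - f r\<bar> \<le> K * (t - r)"
    and rt: "0 \<le> r" "r < t" "t < T"
  shows "\<bar>f t - f r\<bar> \<le> K * (t - r)"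
proof -
  have approx: "\<exists>x. (\<forall>n::nat. x n \<in> \<rat> \<and> p < x n \<and> x n < q) \<and> x \<longlonglongrightarrow> p \<and> (\<lambda>n. f (x n)) \<longlonglongrightarrow> f p"
    if "0 \<le> p" "p < q" "q \<le> T" for p q
  proof -
    have "\<exists>y\<in>\<rat>. p < y \<and> y < min q (p + inverse (real (Suc n)))" for n
      using that by (intro Rats_dense_in_real) auto
    then obtain x where x: "\<And>n. x n \<in> \<rat>" "\<And>n. p < x n" "\<And>n. x n < min q (p + inverse (real (Suc n)))"
      by metis
    have lim: "x \<longlonglongrightarrow> p"
    proof (rule tendsto_sandwich[of "\<lambda>_. p" _ _ "\<lambda>n. p + inverse (real (Suc n))"])
      show "(\<lambda>n. p + inverse (real (Suc n))) \<longlonglongrightarrow> p"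
        using tendsto_add[OF tendsto_const[of p] LIMSEQ_inverse_real_of_nat] by simp
    qed (use x in \<open>auto intro!: always_eventually less_imp_le\<close>)
    then have "filterlim x (at_right p) sequentially"
      using x by (auto simp: filterlim_at intro!: always_eventually less_imp_neq[symmetric])
    moreover have "(f \<longlongrightarrow> f p) (at_right p)"
      using cont that by (simp add: continuous_within)
    ultimately have "(\<lambda>n. f (x n)) \<longlonglongrightarrow> f p" by (rule filterlim_compose[rotated])
    with x lim show ?thesis by (intro exI[of _ x]) auto
  qed
  obtain x where x: "\<And>n::nat. x n \<in> \<rat>" "\<And>n. r < x n" "\<And>n. x n < t" "x \<longlonglongrightarrow> r" "(\<lambda>n. f (x n)) \<longlonglongrightarrow> f r"
    using approx[of r t] rt by auto
  obtain y where y: "\<And>n::nat. y n \<in> \<rat>" "\<And>n. t < y n" "\<And>n. y n < T" "y \<longlonglongrightarrow> t" "(\<lambda>n. f (y n)) \<longlonglongrightarrow> f t"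
    using approx[of t T] rt by auto
  have "\<bar>f (y n) - f (x n)\<bar> \<le> K * (y n - x n)" for n
    using rat[of "x n" "y n"] x(1-3)[of n] y(1-3)[of n] rt by simp
  moreover have "(\<lambda>n. K * (y n - x n)) \<longlonglongrightarrow> K * (t - r)"
    by (intro tendsto_intros x y)
  ultimately show ?thesis
    by (intro tendsto_le[OF sequentially_bot _ tendsto_rabs[OF tendsto_diff[OF y(5) x(5)]]]) auto
qed

lemma finite_variation_on_lipschitz:
  assumes "C-lipschitz_on {a..b} f"
  shows "finite_variation_on {a..b} f"
  unfolding finite_variation_on_def
proof (intro exI allI impI)
  fix n :: nat and p :: "nat \<Rightarrow> real" assume p: "incseq p" "range p \<subseteq> {a..b}"
  have C: "C \<ge> 0" using assms lipschitz_on_nonneg by blast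
  have "(\<Sum>i<n. \<bar>f (p (Suc i)) - f (p i)\<bar>) \<le> (\<Sum>i<n. C * (p (Suc i) - p i))"
  proof (rule sum_mono)
    fix i
    have "dist (f (p (Suc i))) (f (p i)) \<le> C * dist (p (Suc i)) (p i)"
      using p(2) by (intro lipschitz_onD[OF assms] subsetD[OF p(2)] rangeI)
    then show "\<bar>f (p (Suc i)) - f (p i)\<bar> \<le> C * (p (Suc i) - p i)"
      using incseqD[OF p(1), of i "Suc i"] by (simp add: dist_real_def)
  qed
  also have "\<dots> = C * (p n - p 0)"
    by (simp add: sum_distrib_left[symmetric] sum_lessThan_telescope)
  also have "\<dots> \<le> C * (b - a)"
  proof -
    have "p n \<in> {a..b}" "p 0 \<in> {a..b}" by (rule subsetD[OF p(2) rangeI])+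
    then show ?thesis using C by (intro mult_left_mono) auto
  qed
  finally show "(\<Sum>i<n. \<bar>f (p (Suc i)) - f (p i)\<bar>) \<le> C * (b - a)" .
qed

section \<open>Finite variation processes as semimartingales\<close>

lemma local_martingale_zero:
  assumes "prob_space M" "filtration_nonneg M F"
  shows "local_martingale M F (\<lambda>_ _. 0)"
proof -
  interpret prob_space M by fact
  have cond: "AE \<omega> in M. real_cond_exp M (F s) (\<lambda>_. 0) \<omega> = 0" if "s \<ge> 0" for s
  proof -
    interpret finite_measure_subalgebra M "F s"
      using assms(2) that by unfold_locales (auto simp: filtration_nonneg_def)
    show ?thesis by (rule real_cond_exp_F_meas) auto
  qed
  have "martingale M F (\<lambda>t \<omega>. stopped (\<lambda>_ _. 0) (\<lambda>_. \<infinity>) t \<omega> - 0)"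
    unfolding martingale_def adapted_def stopped_def diff_zero using cond by simp
  moreover have "cadlag (\<lambda>_. 0)"
    unfolding cadlag_def by (auto intro: tendsto_const)
  moreover have "extended_stopping_time M F (\<lambda>_. \<infinity>)"
  proof -
    have "\<not> \<infinity> \<le> ennreal t" for t
      unfolding not_le infinity_ennreal_def by (rule ennreal_less_top)
    then have "{\<omega> \<in> space M. \<infinity> \<le> ennreal t} = {}" for t by blast
    then show ?thesis unfolding extended_stopping_time_def by (metis sets.empty_sets)
  qed
  moreover have "adapted F (\<lambda>_ _. 0)" by (simp add: adapted_def)
  moreover have "incseq (\<lambda>_::nat. \<infinity>::ennreal) \<and> (SUP n::nat. \<infinity>::ennreal) = \<infinity>"
    by (simp add: incseq_def)
  ultimately show ?thesis
    unfolding local_martingale_def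
    by (intro conjI exI[of _ "\<lambda>_ _. \<infinity>"] allI AE_I2) blast+
qed

text \<open>The decomposition has martingale part 0 and finite variation part
  \<open>X t - X 0\<close>.\<close>

lemma semimartingale_finite_variation:
  assumes M: "prob_space M" and F: "filtration_nonneg M F" and X: "adapted F X"
    and cadlag: "AE \<omega> in M. cadlag (\<lambda>t. X t \<omega>)" and fv: "finite_variation_paths M X"
  shows "semimartingale M F X"
  unfolding semimartingale_def
proof (intro conjI exI)
  show "local_martingale M F (\<lambda>_ _. 0)" using M F by (rule local_martingale_zero)
  show "adapted F (\<lambda>t \<omega>. X t \<omega> - X 0 \<omega>)"
    unfolding adapted_def
  proof (intro allI impI)
    fix t :: real assume t: "0 \<le> t"
    then have "subalgebra (F t) (F 0)" using F by (auto simp: filtration_nonneg_def)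
    then have "X 0 \<in> borel_measurable (F t)"
      using X by (intro measurable_from_subalg[of "F t" "F 0"]) (auto simp: adapted_def)
    with X t show "(\<lambda>\<omega>. X t \<omega> - X 0 \<omega>) \<in> borel_measurable (F t)"
      by (auto simp: adapted_def)
  qed
  have "cadlag (\<lambda>t. f t - c)" if "cadlag f" for f c
    unfolding cadlag_def
  proof (intro conjI allI impI)
    show "continuous (at_right t) (\<lambda>t. f t - c)" if "0 \<le> t" for t
      using \<open>cadlag f\<close> that by (auto simp: cadlag_def intro!: continuous_intros)
    show "\<exists>y. ((\<lambda>t. f t - c) \<longlongrightarrow> y) (at_left t)" if "0 < t" for t
    proof -
      obtain y where "(f \<longlongrightarrow> y) (at_left t)" using \<open>cadlag f\<close> \<open>0 < t\<close> unfolding cadlag_def by blast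
      then show ?thesis by (intro exI[of _ "y - c"] tendsto_intros)
    qed
  qed
  with cadlag show "AE \<omega> in M. cadlag (\<lambda>t. X t \<omega> - X 0 \<omega>)"
    by (auto elim!: eventually_mono)
  show "finite_variation_paths M (\<lambda>t \<omega>. X t \<omega> - X 0 \<omega>)"
    using fv by (simp add: finite_variation_paths_def finite_variation_on_def)
qed (use X in auto)

text \<open>\<open>\<alpha>\<close> and \<open>\<beta>\<close> are chosen so that \<open>f t - \<alpha> t * f 0 - \<beta> t * f T\<close>, with \<open>f t s = exp (- l * \<bar>t - s\<bar>)\<close>,
  vanishes off \<open>[0, T]\<close>; on \<open>[0, T]\<close> it is a difference of hyperbolic sines.\<close>

lemma levy_ou_increment_bound:
  fixes M :: "'a measure"
  assumes "levy_basis M \<Lambda> \<psi>" and L: "levy_random_measure M L \<Lambda>" and l: "l > 0"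
    and X: "\<And>t. t \<ge> 0 \<Longrightarrow> has_levy_integral M \<Lambda> (\<lambda>s. exp (- l * \<bar>t - s\<bar>)) (X t)"
    and T: "T > 0" and rt: "0 \<le> r" "r \<le> t" "t \<le> T"
  defines "\<alpha> \<equiv> \<lambda>t. sinh (l * (T - t)) / sinh (l * T)" and "\<beta> \<equiv> \<lambda>t. sinh (l * t) / sinh (l * T)"
  shows "AE \<omega> in M. \<forall>C. (\<forall>s\<in>{0..T}. \<bar>L s \<omega>\<bar> \<le> C) \<longrightarrow>
    \<bar>X t \<omega> - X r \<omega> - (\<alpha> t - \<alpha> r) * X 0 \<omega> - (\<beta> t - \<beta> r) * X T \<omega>\<bar>
      \<le> C * (4 * (sinh (l * t) - sinh (l * r)))"
proof -
  interpret levy_basis M \<Lambda> \<psi> by fact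
  let ?f = "\<lambda>t s. exp (- l * \<bar>t - s\<bar>)"
  let ?S = "sinh (l * T)"
  define a where "a = \<alpha> t - \<alpha> r"
  define b where "b = \<beta> t - \<beta> r"
  define h where "h s = ?f t s + (- 1) * ?f r s + (- a) * ?f 0 s + (- b) * ?f T s" for s
  have S: "?S > 0" using l T by simp
  \<comment> \<open>Two linear equations that determine the coefficients: the first matches the
    kernels for \<open>s \<le> 0\<close>, the second for \<open>s \<ge> T\<close>.\<close>
  have \<alpha>\<beta>: "\<alpha> t + \<beta> t * exp (- l * T) = exp (- l * t)" "\<alpha> t + \<beta> t * exp (l * T) = exp (l * t)" for t
  proof -
    have "sinh (l * (T - t)) + sinh (l * t) * exp (- l * T) = exp (- l * t) * ?S"
      "sinh (l * (T - t)) + sinh (l * t) * exp (l * T) = exp (l * t) * ?S"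
      by (simp_all add: sinh_def algebra_simps exp_diff flip: exp_add)
    moreover have "\<alpha> t + \<beta> t * e = (sinh (l * (T - t)) + sinh (l * t) * e) / ?S" for e
      by (simp add: \<alpha>_def \<beta>_def add_divide_distrib)
    ultimately show "\<alpha> t + \<beta> t * exp (- l * T) = exp (- l * t)" "\<alpha> t + \<beta> t * exp (l * T) = exp (l * t)"
      using l T by simp_all
  qed
  have ab: "a + b * exp (- l * T) = exp (- l * t) - exp (- l * r)"
    "a + b * exp (l * T) = exp (l * t) - exp (l * r)"
    using \<alpha>\<beta>[of t] \<alpha>\<beta>[of r] by (simp_all add: a_def b_def algebra_simps)
  have h: "has_levy_integral M \<Lambda> h (\<lambda>\<omega>. X t \<omega> + (- 1) * X r \<omega> + (- a) * X 0 \<omega> + (- b) * X T \<omega>)"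
    unfolding h_def using rt T by (intro has_levy_integral_add_cmult X) auto
  \<comment> \<open>On \<open>[0, T]\<close> the kernels are rewritten by
    \<open>exp_minus_abs_eq\<close>. The exponentials cancel by the second equation in
    \<open>ab\<close>; the kink of \<open>f T\<close> leaves \<open>\<phi>\<close>, those of
    \<open>f t\<close> and \<open>f r\<close> leave \<open>\<phi>'\<close>.\<close>
  define \<phi> where "\<phi> s = 2 * b * sinh (l * (T - s))" for s
  define \<phi>' where "\<phi>' s = 2 * (sinh (l * max (t - s) 0) - sinh (l * max (r - s) 0))" for s
  have "AE \<omega> in M. \<forall>C. (\<forall>s\<in>{0..T}. \<bar>L s \<omega>\<bar> \<le> C) \<longrightarrow>
    \<bar>X t \<omega> + (- 1) * X r \<omega> + (- a) * X 0 \<omega> + (- b) * X T \<omega>\<bar> \<le> C * (\<phi> 0 - \<phi> T + \<phi>' 0 - \<phi>' T)"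
  proof (rule levy_integral_bound[OF L h T])
    let ?K = "l + l + \<bar>a\<bar> * l + \<bar>b\<bar> * l"
    show "?K \<ge> 0" using l by simp
    show "\<bar>h x - h y\<bar> \<le> ?K * \<bar>x - y\<bar>" for x y
    proof -
      have f: "\<bar>?f u x - ?f u y\<bar> \<le> l * \<bar>x - y\<bar>" for u
        using exp_minus_abs_lipschitz[of l "u - x" "u - y"] l by (simp add: abs_minus_commute)
      have cf: "\<bar>c * (?f u x - ?f u y)\<bar> \<le> \<bar>c\<bar> * (l * \<bar>x - y\<bar>)" for c u
        unfolding abs_mult by (intro mult_left_mono f) auto
      have "h x - h y = (?f t x - ?f t y) - (?f r x - ?f r y) - a * (?f 0 x - ?f 0 y) - b * (?f T x - ?f T y)"
        by (simp add: h_def algebra_simps)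
      also have "\<bar>\<dots>\<bar> \<le> \<bar>?f t x - ?f t y\<bar> + \<bar>?f r x - ?f r y\<bar> + \<bar>a * (?f 0 x - ?f 0 y)\<bar> + \<bar>b * (?f T x - ?f T y)\<bar>"
        by (intro order_trans[OF abs_triangle_ineq4] add_mono order_refl)
      also have "\<dots> \<le> l * \<bar>x - y\<bar> + l * \<bar>x - y\<bar> + \<bar>a\<bar> * (l * \<bar>x - y\<bar>) + \<bar>b\<bar> * (l * \<bar>x - y\<bar>)"
        by (intro add_mono f cf)
      finally show ?thesis by (simp add: algebra_simps)
    qed
    show "h s = 0" if "s \<le> 0 \<or> s \<ge> T" for s
      using that
    proof
      assume s: "s \<le> 0"
      have f: "?f u s = exp (- l * u) * exp (l * s)" if "u \<ge> 0" for u
        using s that by (simp add: algebra_simps flip: exp_add)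
      have "h s = (exp (- l * t) - exp (- l * r) - (a + b * exp (- l * T))) * exp (l * s)"
        unfolding h_def using f[of t] f[of r] f[of 0] f[of T] rt T by (simp add: algebra_simps)
      then show ?thesis using ab(1) by simp
    next
      assume s: "s \<ge> T"
      have f: "?f u s = exp (l * u) * exp (- l * s)" if "u \<le> T" for u
        using s that by (simp add: algebra_simps flip: exp_add)
      have "h s = (exp (l * t) - exp (l * r) - (a + b * exp (l * T))) * exp (- l * s)"
        unfolding h_def using f[of t] f[of r] f[of 0] f[of T] rt T s by (simp add: algebra_simps)
      then show ?thesis using ab(2) by simp
    qed
    show "h s = \<phi> s - \<phi>' s" if s: "0 \<le> s" "s \<le> T" for s
    proof -
      have f: "?f u s = exp (l * u) * exp (- l * s) - 2 * sinh (l * max (u - s) 0)" for u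
        using exp_minus_abs_eq[of l "u - s"] by (simp add: algebra_simps flip: exp_add)
      have f0: "?f 0 s = exp (- l * s)" using s by simp
      have fT: "?f T s = exp (l * T) * exp (- l * s) - 2 * sinh (l * (T - s))" using f[of T] s by simp
      have "h s = (exp (l * t) - exp (l * r) - (a + b * exp (l * T))) * exp (- l * s) + \<phi> s - \<phi>' s"
        unfolding h_def f[of t] f[of r] f0 fT \<phi>_def \<phi>'_def by (simp add: algebra_simps)
      then show ?thesis using ab(2) by simp
    qed
    have "b \<ge> 0" using rt l S by (simp add: b_def \<beta>_def divide_right_mono)
    then show "antimono_on {0..T} \<phi>"
      using l by (auto simp: \<phi>_def monotone_on_def intro!: mult_left_mono)
    show "antimono_on {0..T} \<phi>'"
    proof (rule monotone_onI)
      fix s s' :: real assume "s \<le> s'"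
      \<comment> \<open>Between \<open>(r - s)\<close> and \<open>(t - s)\<close>, cut off at 0,
        lies an interval whose left endpoint and length both decrease weakly as \<open>s\<close>
        grows.\<close>
      have "sinh (l * max (t - s') 0) - sinh (l * max (r - s') 0) \<le>
          sinh (l * max (t - s) 0) - sinh (l * max (r - s) 0)"
      proof (rule sinh_increment_mono)
        have "max (t - s') 0 - max (r - s') 0 \<le> max (t - s) 0 - max (r - s) 0"
          using \<open>s \<le> s'\<close> rt by (auto simp: max_def)
        then have "l * (max (t - s') 0 - max (r - s') 0) \<le> l * (max (t - s) 0 - max (r - s) 0)"
          using l by (intro mult_left_mono) auto
        then show "l * max (t - s') 0 - l * max (r - s') 0 \<le> l * max (t - s) 0 - l * max (r - s) 0"
          by (simp add: algebra_simps)
      qed (use l rt \<open>s \<le> s'\<close> in \<open>auto intro!: mult_left_mono\<close>)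
      then show "\<phi>' s' \<le> \<phi>' s" by (simp add: \<phi>'_def)
    qed
  qed
  \<comment> \<open>Each of the two functions decreases in total by
    \<open>2 * (sinh (l * t) - sinh (l * r))\<close>: for \<open>\<phi>\<close>, the factor
    \<open>sinh (l * T)\<close> cancels the denominator in \<open>b\<close>.\<close>
  also have "\<phi> 0 - \<phi> T + \<phi>' 0 - \<phi>' T = 4 * (sinh (l * t) - sinh (l * r))"
    using rt S T by (simp add: \<phi>_def \<phi>'_def b_def \<beta>_def max_def field_simps)
  finally show ?thesis by (simp add: a_def b_def algebra_simps)
qed

theorem theorem3p1:
  fixes M :: "'a measure" and L X :: "real \<Rightarrow> 'a \<Rightarrow> real"
    and \<Lambda> :: "real set \<Rightarrow> 'a \<Rightarrow> real" and \<nu> :: "real measure" and l \<gamma> \<sigma> :: real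
  assumes "prob_space M"
    and "l > 0"
    and "two_sided_levy_process M L \<gamma> \<sigma> \<nu>"
    and "set_integrable \<nu> {x. \<bar>x\<bar> > 1} (\<lambda>x. ln \<bar>x\<bar>)"
    and "levy_random_measure M L \<Lambda>"
    and "\<forall>t\<ge>0. has_levy_integral M \<Lambda> (\<lambda>s. exp (- l * \<bar>t - s\<bar>)) (X t)"
    and "AE \<omega> in M. cadlag (\<lambda>t. X t \<omega>)"
  shows "finite_variation_paths M X \<and>
    (\<forall>F. filtration_nonneg M F \<longrightarrow> adapted F X \<longrightarrow> semimartingale M F X) \<and>
    (AE \<omega> in M. \<forall>a b. 0 \<le> a \<longrightarrow> (\<exists>C. C-lipschitz_on {a..b} (\<lambda>t. X t \<omega>)))"
proof -
  note l = assms(2)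
  have basis: "levy_basis M \<Lambda> (levy_exponent \<gamma> \<sigma> \<nu>)"
    using assms(1,3,5) by (rule levy_basis_two_sided_levy_process)
  define \<alpha> where "\<alpha> T t = sinh (l * (T - t)) / sinh (l * T)" for T t
  define \<beta> where "\<beta> T t = sinh (l * t) / sinh (l * T)" for T t
  \<comment> \<open>Countably many rational times and integer horizons share one null set.\<close>
  have AE_bound: "AE \<omega> in M. \<forall>n. \<forall>r\<in>\<rat>. \<forall>t\<in>\<rat>. 0 \<le> r \<longrightarrow> r \<le> t \<longrightarrow> t \<le> real (Suc n) \<longrightarrow>
    (\<forall>C. (\<forall>s\<in>{0..real (Suc n)}. \<bar>L s \<omega>\<bar> \<le> C) \<longrightarrow>
      \<bar>X t \<omega> - X r \<omega> - (\<alpha> (Suc n) t - \<alpha> (Suc n) r) * X 0 \<omega> - (\<beta> (Suc n) t - \<beta> (Suc n) r) * X (Suc n) \<omega>\<bar>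
        \<le> C * (4 * (sinh (l * t) - sinh (l * r))))"
    unfolding AE_all_countable AE_ball_countable[OF countable_rat] \<alpha>_def \<beta>_def
    using levy_ou_increment_bound[OF basis assms(5) l] assms(6) by auto
  have AE_L: "AE \<omega> in M. \<forall>T\<ge>0. \<exists>C. \<forall>s\<in>{0..T}. \<bar>L s \<omega>\<bar> \<le> C"
  proof -
    obtain L1 where "levy_process M L1" "AE \<omega> in M. \<forall>t\<ge>0. L t \<omega> = L1 t \<omega>"
      using assms(3) unfolding two_sided_levy_process_def by auto
    then have "AE \<omega> in M. cadlag (\<lambda>t. L1 t \<omega>)" "AE \<omega> in M. \<forall>t\<ge>0. L t \<omega> = L1 t \<omega>"
      by (auto simp: levy_process_def)
    then show ?thesis
      by eventually_elim (use cadlag_bounded in auto)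
  qed
  have lipschitz: "AE \<omega> in M. \<forall>a b. 0 \<le> a \<longrightarrow> (\<exists>C. C-lipschitz_on {a..b} (\<lambda>t. X t \<omega>))"
    using AE_bound AE_L assms(7)
  proof eventually_elim
    case (elim \<omega>)
    show ?case
    proof (intro allI impI)
      fix a b :: real assume a: "0 \<le> a"
      \<comment> \<open>The horizon \<open>Suc n\<close> lies strictly above \<open>b\<close>, so
        that points of \<open>[a, b]\<close> can be approached by rationals from the right.\<close>
      define n where "n = nat \<lceil>\<bar>b\<bar>\<rceil>"
      let ?T = "real (Suc n)"
      have b: "b < ?T" unfolding n_def by linarith
      obtain C where C: "\<forall>s\<in>{0..?T}. \<bar>L s \<omega>\<bar> \<le> C" using elim(2)[rule_format, of ?T] by auto
      have "C \<ge> 0" using C[rule_format, of 0] by simp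
      define S where "S = sinh (l * ?T)"
      have S: "S > 0" using l by (simp add: S_def)
      define c where "c = cosh (l * ?T) * l"
      have c: "c \<ge> 0" using l by (simp add: c_def)
      \<comment> \<open>The first two terms come from the increments of \<open>\<alpha>\<close> and
        \<open>\<beta>\<close>, each at most \<open>c / S * (t - r)\<close>; the last bounds the
        remaining integral of \<open>h\<close>. Here \<open>c\<close> is a Lipschitz constant of
        \<open>sinh (l * t)\<close> on the horizon.\<close>
      define K where "K = c / S * \<bar>X 0 \<omega>\<bar> + c / S * \<bar>X ?T \<omega>\<bar> + C * (4 * c)"
      have K: "K \<ge> 0" using c S \<open>C \<ge> 0\<close> by (simp add: K_def)
      have sinh: "0 \<le> sinh (l * t) - sinh (l * r)" "sinh (l * t) - sinh (l * r) \<le> c * (t - r)"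
        if "0 \<le> r" "r \<le> t" "t \<le> ?T" for r t
      proof -
        have "0 \<le> l * r" "l * r \<le> l * t" "l * t \<le> l * ?T"
          using that l by (auto intro: mult_left_mono)
        from this sinh_diff_le[OF this]
        show "0 \<le> sinh (l * t) - sinh (l * r)" "sinh (l * t) - sinh (l * r) \<le> c * (t - r)"
          by (auto simp: c_def algebra_simps)
      qed
      have rat: "\<bar>X t \<omega> - X r \<omega>\<bar> \<le> K * (t - r)"
        if "r \<in> \<rat>" "t \<in> \<rat>" "0 \<le> r" "r \<le> t" "t \<le> ?T" for r t
      proof -
        have "\<bar>\<alpha> ?T t - \<alpha> ?T r\<bar> \<le> c / S * (t - r)"
        proof -
          have "\<bar>\<alpha> ?T t - \<alpha> ?T r\<bar> = (sinh (l * (?T - r)) - sinh (l * (?T - t))) / S"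
            using sinh(1)[of "?T - t" "?T - r"] that S
            unfolding \<alpha>_def S_def[symmetric] diff_divide_distrib[symmetric]
            by simp
          also have "\<dots> \<le> (c * (t - r)) / S"
            using sinh(2)[of "?T - t" "?T - r"] that S by (intro divide_right_mono) auto
          finally show ?thesis by simp
        qed
        then have 1: "\<bar>(\<alpha> ?T t - \<alpha> ?T r) * X 0 \<omega>\<bar> \<le> c / S * (t - r) * \<bar>X 0 \<omega>\<bar>"
          unfolding abs_mult by (rule mult_right_mono) simp
        have "\<bar>\<beta> ?T t - \<beta> ?T r\<bar> \<le> c / S * (t - r)"
        proof -
          have "\<bar>\<beta> ?T t - \<beta> ?T r\<bar> = (sinh (l * t) - sinh (l * r)) / S"
            using sinh(1)[of r t] that S
            unfolding \<beta>_def S_def[symmetric] diff_divide_distrib[symmetric]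
            by simp
          also have "\<dots> \<le> (c * (t - r)) / S"
            using sinh(2)[of r t] that S by (intro divide_right_mono) auto
          finally show ?thesis by simp
        qed
        then have 2: "\<bar>(\<beta> ?T t - \<beta> ?T r) * X ?T \<omega>\<bar> \<le> c / S * (t - r) * \<bar>X ?T \<omega>\<bar>"
          unfolding abs_mult by (rule mult_right_mono) simp
        have "C * (4 * (sinh (l * t) - sinh (l * r))) \<le> C * (4 * (c * (t - r)))"
          using sinh(2)[of r t] that \<open>C \<ge> 0\<close> by (intro mult_left_mono) auto
        then have 3: "\<bar>X t \<omega> - X r \<omega> - (\<alpha> ?T t - \<alpha> ?T r) * X 0 \<omega> - (\<beta> ?T t - \<beta> ?T r) * X ?T \<omega>\<bar>
            \<le> C * (4 * (c * (t - r)))"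
          using elim(1)[rule_format, OF that C[rule_format]] by linarith
        have "K * (t - r) = c / S * (t - r) * \<bar>X 0 \<omega>\<bar> + c / S * (t - r) * \<bar>X ?T \<omega>\<bar> + C * (4 * (c * (t - r)))"
          by (simp add: K_def algebra_simps)
        with 1 2 3 show ?thesis by arith
      qed
      have "dist (X t \<omega>) (X r \<omega>) \<le> K * dist t r" if "r \<in> {a..b}" "t \<in> {a..b}" "r < t" for r t
        using lipschitz_if_lipschitz_on_Rats[of ?T "\<lambda>t. X t \<omega>" K r t, OF _ rat] elim(3) that a b
        by (auto simp: cadlag_def dist_real_def)
      then have "K-lipschitz_on {a..b} (\<lambda>t. X t \<omega>)"
        using K by (intro lipschitz_onI) (metis dist_commute dist_self linorder_neqE_linordered_idom mult_zero_right order_refl)+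
      then show "\<exists>C. C-lipschitz_on {a..b} (\<lambda>t. X t \<omega>)" by blast
    qed
  qed
  then have fv: "finite_variation_paths M X"
    unfolding finite_variation_paths_def
    by eventually_elim (blast intro: finite_variation_on_lipschitz)
  with lipschitz semimartingale_finite_variation[OF assms(1) _ _ assms(7) fv] show ?thesis
    by blast
qed

end
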